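(* There is an algorithm that computes $G_H(x,y)$ exactly for every $(x,y)\in\mathbb{Z}^2$ with $x+y$ even and $y\ge 0$. It uses only the following values and relations of $G_H$: (1) $\sum_{k\ge 0} G_H(2k,0)\,z^{2k} = \dfrac{1}{\sqrt{1-z^2}}$ (values on the nonnegative horizontal axis); (2) $G_H(0,2k)+G_H(0,2k+2)=\sqrt{2}\,G_H(2k,0)$ for all integers $k\ge 0$ (values on the vertical axis); (3) $G_H(0,y)=G_H(-1,y-1)$ for all even $y>0$; (4) the recurrence given by harmonicity of $G_H$ (inherited from harmonicity of $v\mapsto G_D((0,0),v)$ off $D\cup\{(0,0)\}$, its vanishing on $D$, and its symmetry under reflection in the diagonal). As a consequence, all values $G_H(x,y)$ lie in $\mathbb{Q}[\sqrt{2}]$; in fact they lie in $\mathbb{Z}[\tfrac12][\sqrt 2]$, i.e. each is of the form $a+b\sqrt{2}$ with $a,b$ dyadic rationals.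
   Context: Consider the square lattice $\mathbb{Z}^2$ with unit conductances and Laplacian $\Delta f(v)=\sum_{v'\sim v}(f(v)-f(v'))$. Let $D=\{(k,k): k\in\mathbb{Z},\ k\le -1\}$ and let $G_D$ be the Green's function on $\mathbb{Z}^2\setminus D$ with Dirichlet boundary conditions on $D$ (the inverse of the Laplacian acting on functions vanishing on $D$; equivalently $G_D(u,v)$ is the expected total time spent at $v$, before hitting $D$, by the continuous-time random walk started at $u$ that jumps at rate $1$ along each edge). $G_D(u,v)=0$ if $v\in D$. For $(x,y)\in\mathbb{Z}^2$ with $x+y$ even and $y\ge 0$ define $$G_H(x,y)=2\,G_D\left((0,0),\Big(\frac{x-y}{2},\frac{x+y}{2}\Big)\right).$$ In these rotated coordinates the neighbours of $(x,y)$ are $(x\pm1,y\pm1)$, and the negative diagonal $D$ becomes $\{(2k,0):k\le -1\}$. Explicitly, harmonicity reads: $4G_H(x,y)=\sum_{\pm,\pm}G_H(x\pm1,y\pm1)$ for $y\ge1$; $2G_H(x,0)=G_H(x-1,1)+G_H(x+1,1)$ for even $x>0$; $G_H(x,0)=0$ for even $x<0$; and $2G_H(0,0)-G_H(1,1)-G_H(-1,1)=1$.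
   Formalization: Relations (1)-(4) do not determine the values at x ≤ -3. "It uses only (1)-(4)" is therefore proved as: the algorithm is correct for every function satisfying (1)-(4) where x ≥ -2, and for x ≤ -3 if the function is also bounded; G_H is proved bounded. *)

theory Defs
  imports "HOL-Probability.Probability"
begin

section \<open>The Green's function of the plane slit along the negative diagonal\<close>

text \<open>
  The continuous-time walk that jumps at rate 1 along each of the four edges is built from
  independent pairs (step, holding time): the step is uniform on the four unit vectors and
  the holding time is exponential with rate 4.
\<close>

definition unit_steps :: "(int \<times> int) set" where
  "unit_steps = {(1, 0), (-1, 0), (0, 1), (0, -1)}"

definition walk_space :: "(nat \<Rightarrow> (int \<times> int) \<times> real) measure" where
  "walk_space =
     PiM UNIV (\<lambda>_. measure_pmf (pmf_of_set unit_steps)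
       \<Otimes>\<^sub>M density lborel (\<lambda>t. ennreal (exponential_density 4 t)))"

text \<open>Position, for the walk started at \<open>u\<close>, after \<open>n\<close> jumps; it stays there for time
  \<open>snd (\<omega> n)\<close>.\<close>

definition walk_pos :: "int \<times> int \<Rightarrow> (nat \<Rightarrow> (int \<times> int) \<times> real) \<Rightarrow> nat \<Rightarrow> int \<times> int" where
  "walk_pos u \<omega> n = (fst u + (\<Sum>i<n. fst (fst (\<omega> i))), snd u + (\<Sum>i<n. snd (fst (\<omega> i))))"

definition time_spent ::
    "(int \<times> int) set \<Rightarrow> int \<times> int \<Rightarrow> int \<times> int \<Rightarrow> (nat \<Rightarrow> (int \<times> int) \<times> real) \<Rightarrow> ennreal" where
  "time_spent D u v \<omega> =
     (\<Sum>n. if walk_pos u \<omega> n = v \<and> (\<forall>k\<le>n. walk_pos u \<omega> k \<notin> D)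
           then ennreal (snd (\<omega> n)) else 0)"

definition greens_function :: "(int \<times> int) set \<Rightarrow> int \<times> int \<Rightarrow> int \<times> int \<Rightarrow> real" where
  "greens_function D u v = enn2real (\<integral>\<^sup>+ \<omega>. time_spent D u v \<omega> \<partial>walk_space)"

definition neg_diagonal :: "(int \<times> int) set" where
  "neg_diagonal = {(k, k) | k. k \<le> -1}"

text \<open>Only meaningful for \<open>x + y\<close> even and \<open>y \<ge> 0\<close>.\<close>

definition G_H :: "int \<Rightarrow> int \<Rightarrow> real" where
  "G_H x y = 2 * greens_function neg_diagonal (0, 0) ((x - y) div 2, (x + y) div 2)"

definition in_domain :: "int \<Rightarrow> int \<Rightarrow> bool" where
  "in_domain x y \<longleftrightarrow> even (x + y) \<and> 0 \<le> y"


section \<open>The values and relations used by the algorithm\<close>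

definition horizontal_axis_values :: "(int \<Rightarrow> int \<Rightarrow> real) \<Rightarrow> bool" where
  "horizontal_axis_values F \<longleftrightarrow>
     (\<forall>z::real. \<bar>z\<bar> < 1 \<longrightarrow> (\<lambda>k::nat. F (2 * int k) 0 * z ^ (2 * k)) sums (1 / sqrt (1 - z\<^sup>2)))"

definition vertical_axis_relation :: "(int \<Rightarrow> int \<Rightarrow> real) \<Rightarrow> bool" where
  "vertical_axis_relation F \<longleftrightarrow>
     (\<forall>k\<ge>0. F 0 (2 * k) + F 0 (2 * k + 2) = sqrt 2 * F (2 * k) 0)"

definition adjacent_column_relation :: "(int \<Rightarrow> int \<Rightarrow> real) \<Rightarrow> bool" where
  "adjacent_column_relation F \<longleftrightarrow> (\<forall>y>0. even y \<longrightarrow> F 0 y = F (-1) (y - 1))"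

definition harmonicity_recurrence :: "(int \<Rightarrow> int \<Rightarrow> real) \<Rightarrow> bool" where
  "harmonicity_recurrence F \<longleftrightarrow>
     (\<forall>x y. even (x + y) \<and> 1 \<le> y \<longrightarrow>
        4 * F x y = F (x + 1) (y + 1) + F (x + 1) (y - 1) + F (x - 1) (y + 1) + F (x - 1) (y - 1))
   \<and> (\<forall>x>0. even x \<longrightarrow> 2 * F x 0 = F (x - 1) 1 + F (x + 1) 1)
   \<and> (\<forall>x<0. even x \<longrightarrow> F x 0 = 0)
   \<and> 2 * F 0 0 - F 1 1 - F (-1) 1 = 1"

definition green_relations :: "(int \<Rightarrow> int \<Rightarrow> real) \<Rightarrow> bool" where
  "green_relations F \<longleftrightarrow>
     horizontal_axis_values F \<and> vertical_axis_relation F \<and>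
     adjacent_column_relation F \<and> harmonicity_recurrence F"

text \<open>
  The relations above determine \<open>F\<close> only on the columns \<open>x \<ge> -2\<close>: no relation is available at
  the points of the slit, so the value at \<open>(x, 1)\<close> is a free parameter for each odd \<open>x \<le> -3\<close>.
  Boundedness, a basic property of a Green's function, removes this freedom, since every
  nontrivial perturbation grows without bound.
\<close>

definition bounded_on_domain :: "(int \<Rightarrow> int \<Rightarrow> real) \<Rightarrow> bool" where
  "bounded_on_domain F \<longleftrightarrow> (\<exists>C. \<forall>x y. in_domain x y \<longrightarrow> \<bar>F x y\<bar> \<le> C)"


section \<open>Algorithms\<close>

text \<open>
  A program is a finite system of mutually recursive equations over the integers (McCarthy's
  model of computation): the \<open>i\<close>-th entry of the list is the body of the \<open>i\<close>-th function.
  Evaluation is call by value, except that \<open>IfLe a b c d\<close> evaluates only the branch selected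
  by the test \<open>a \<le> b\<close>.
\<close>

datatype expr =
    Const int
  | Arg nat
  | Add expr expr
  | Sub expr expr
  | Mul expr expr
  | IfLe expr expr expr expr
  | Call nat "expr list"

type_synonym program = "expr list"

inductive eval :: "program \<Rightarrow> int list \<Rightarrow> expr \<Rightarrow> int \<Rightarrow> bool" for P :: program where
  "eval P xs (Const c) c"
| "i < length xs \<Longrightarrow> eval P xs (Arg i) (xs ! i)"
| "eval P xs a u \<Longrightarrow> eval P xs b v \<Longrightarrow> eval P xs (Add a b) (u + v)"
| "eval P xs a u \<Longrightarrow> eval P xs b v \<Longrightarrow> eval P xs (Sub a b) (u - v)"
| "eval P xs a u \<Longrightarrow> eval P xs b v \<Longrightarrow> eval P xs (Mul a b) (u * v)"
| "eval P xs a u \<Longrightarrow> eval P xs b v \<Longrightarrow> u \<le> v \<Longrightarrow> eval P xs c w \<Longrightarrow> eval P xs (IfLe a b c d) w"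
| "eval P xs a u \<Longrightarrow> eval P xs b v \<Longrightarrow> v < u \<Longrightarrow> eval P xs d w \<Longrightarrow> eval P xs (IfLe a b c d) w"
| "list_all2 (eval P xs) es vs \<Longrightarrow> f < length P \<Longrightarrow> eval P vs (P ! f) w \<Longrightarrow>
     eval P xs (Call f es) w"

inductive_cases eval_elims:
  "eval P xs (Const c) w" "eval P xs (Arg i) w" "eval P xs (Add a b) w" "eval P xs (Sub a b) w"
  "eval P xs (Mul a b) w" "eval P xs (IfLe a b c d) w" "eval P xs (Call f es) w"

lemma eval_deterministic: "eval P xs e v \<Longrightarrow> eval P xs e w \<Longrightarrow> w = v"
proof (induction arbitrary: w rule: eval.induct)
  case (1 xs c)
  then show ?case by (rule eval_elims(1))
next
  case (2 i xs)
  from "2.prems" show ?case by (rule eval_elims(2))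
next
  case (3 xs a u b v)
  from "3.prems" show ?case by (rule eval_elims(3)) (use "3.IH" in blast)
next
  case (4 xs a u b v)
  from "4.prems" show ?case by (rule eval_elims(4)) (use "4.IH" in blast)
next
  case (5 xs a u b v)
  from "5.prems" show ?case by (rule eval_elims(5)) (use "5.IH" in blast)
next
  case (6 xs a u b v c w d)
  from "6.prems" show ?case
  proof (rule eval_elims(6))
    fix u' v'
    assume "eval P xs a u'" "eval P xs b v'" "v' < u'"
    then show ?thesis using "6.IH" "6.hyps" by (metis not_le)
  qed (use "6.IH" in blast)
next
  case (7 xs a u b v d w c)
  from "7.prems" show ?case
  proof (rule eval_elims(6))
    fix u' v'
    assume "eval P xs a u'" "eval P xs b v'" "u' \<le> v'"
    then show ?thesis using "7.IH" "7.hyps" by (metis not_le)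
  qed (use "7.IH" in blast)
next
  case (8 xs es vs f v)
  from "8.prems" obtain us where us: "list_all2 (eval P xs) es us" "eval P us (P ! f) w"
    by (rule eval_elims(7))
  have "us = vs"
    using us(1) "8.IH"(1) unfolding list_all2_conv_all_nth by (metis nth_equalityI)
  with us(2) "8.IH"(2) show ?case by blast
qed

definition run :: "program \<Rightarrow> nat \<Rightarrow> int list \<Rightarrow> int \<Rightarrow> bool" where
  "run P f xs v \<longleftrightarrow> f < length P \<and> eval P xs (P ! f) v"

text \<open>
  Exact computation of a real number on input \<open>(x, y)\<close>: functions 0, 1, 2 of the program
  terminate and return integers \<open>p\<close>, \<open>q\<close>, \<open>n \<ge> 0\<close> such that the number is
  \<open>(p + q * sqrt 2) / 2 ^ n\<close>.
\<close>

definition computes_at :: "program \<Rightarrow> int \<Rightarrow> int \<Rightarrow> real \<Rightarrow> bool" where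
  "computes_at P x y r \<longleftrightarrow>
     (\<exists>p q n. run P 0 [x, y] p \<and> run P 1 [x, y] q \<and> run P 2 [x, y] (int n) \<and>
        r = (of_int p + of_int q * sqrt 2) / 2 ^ n)"


section \<open>Number rings\<close>

definition rat_sqrt2 :: "real set" where
  "rat_sqrt2 = {a + b * sqrt 2 | a b. a \<in> \<rat> \<and> b \<in> \<rat>}"

definition dyadic_rationals :: "real set" where
  "dyadic_rationals = {of_int m / 2 ^ n | (m::int) (n::nat). True}"

definition dyadic_sqrt2 :: "real set" where
  "dyadic_sqrt2 = {a + b * sqrt 2 | a b. a \<in> dyadic_rationals \<and> b \<in> dyadic_rationals}"

end

theory Submission
  imports Defs
begin

text \<open>
  In the rotated coordinates the four unit steps become \<open>(\<plusminus>1, \<plusminus>1)\<close>, and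
  \<open>exp (\<i> * x * \<theta>) * r ^ y\<close> is harmonic exactly if \<open>cos \<theta> * (r + 1 / r) = 2\<close>. The Green's
  function solves a Dirichlet problem in the upper half plane and decays there as \<open>y\<close>
  grows, and its values on the axis are a Wiener-Hopf factor: the trace of the walk on the
  axis has a symmetric jump law with characteristic function \<open>1 - \<bar>sin \<theta>\<bar>\<close>, and
  \<open>2 * \<bar>sin \<theta>\<bar> = \<bar>1 - exp (2 * \<i> * \<theta>)\<bar>\<close>, so the Green's function of the trace killed on the
  negative half-axis has, up to a constant factor, the generating function
  \<open>(1 - z\<^sup>2) powr (- 1 / 2)\<close>. Superposition of the harmonic exponentials with these
  boundary values, followed by the substitution \<open>r = sin t\<close>, leads to
    \<open>G_H x y = 2 * sqrt 2 / \<pi> * integral {0..\<pi> / 2} (\<lambda>t. sin t ^ y * kern x t)\<close>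
  with a smooth bounded kernel (\<open>G_H_eq_slit_green\<close>).

  The proof takes this integral as a definition and verifies its properties. Harmonicity
  above the axis and the relation between columns \<open>0\<close> and \<open>- 1\<close> are identities between
  integrands, and the relation on the vertical axis is Wallis' integral. The values on the
  axis, and the charges (the Laplacian on the axis), satisfy two-term recurrences by
  integration by parts. Vanishing coefficients of these recurrences produce the zeros on
  the slit and the absence of charge on the positive axis.

  That the integral is the Green's function follows by iterating the Poisson equation
  (\<open>greens_function_unique\<close>). After \<open>n\<close> steps the remainder is bounded by the average of a
  function that is small far from the diagonal. The signed distance from the diagonal
  performs a simple random walk, so the remainder tends to zero. First-step analysis on the
  path space turns the definition by occupation times into the sum of transition
  probabilities that this argument needs.

  For uniqueness, the difference of two solutions vanishes on columns \<open>0\<close> and \<open>- 1\<close>, hence,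
  column by column, everywhere to the right and on column \<open>- 2\<close>. Further to the left a
  bounded difference vanishes, since a nonzero odd column would force linear growth in the
  next one (\<open>green_relations_unique\<close>).

  The program follows the same propagation. To the left of the slit's end it uses the
  charges on the slit, which are the coefficients of \<open>sqrt (1 - w)\<close>. All relations are
  linear with integer coefficients apart from a single \<open>sqrt 2\<close>, and the initial data are
  dyadic, so both components can be computed in integers after multiplication by a power of
  two. The form of the output gives membership in the number rings.
\<close>

section \<open>The coefficients of the inverse square root\<close>

text \<open>
  The coefficients of \<open>(1 - w) powr (- 1 / 2)\<close>; also the probability that simple random
  walk on the integers is at its starting point at time \<open>2 * k\<close>.
\<close>

definition cbin :: "nat \<Rightarrow> real" where
  "cbin k = real ((2 * k) choose k) / 4 ^ k"

lemma cbin_0 [simp]: "cbin 0 = 1"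
  by (simp add: cbin_def)

lemma cbin_nonneg: "0 \<le> cbin k"
  by (simp add: cbin_def)

lemma cbin_Suc: "2 * (real k + 1) * cbin (Suc k) = (2 * real k + 1) * cbin k"
proof -
  \<comment> \<open>Two absorption identities relate the central binomial coefficients through the middle of an odd row.\<close>
  have "real (Suc k) * real ((2 * k + 2) choose Suc k) = real (2 * k + 2) * real ((2 * k + 1) choose k)"
    using Suc_times_binomial_eq[of "2 * k + 1" k] by (metis Suc_eq_plus1 add_Suc_right mult.commute of_nat_mult one_add_one plus_1_eq_Suc)
  moreover have "real (Suc k) * real ((2 * k + 1) choose k) = real (2 * k + 1) * real ((2 * k) choose k)"
  proof -
    have "Suc k * ((2 * k + 1) choose k) = (2 * k + 1) * ((2 * k) choose k)"
      using binomial_absorb_comp[of "2 * k + 1" k] by (simp add: mult_2)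
    then show ?thesis by (metis of_nat_mult)
  qed
  ultimately have "real (Suc k) * (real (Suc k) * real ((2 * k + 2) choose Suc k))
      = real (Suc k) * (2 * real (2 * k + 1) * real ((2 * k) choose k))"
    by (simp add: algebra_simps)
  then have *: "real (Suc k) * real ((2 * k + 2) choose Suc k) = 2 * real (2 * k + 1) * real ((2 * k) choose k)"
    by (simp del: of_nat_Suc)
  have "cbin (Suc k) = real ((2 * k + 2) choose Suc k) / (4 * 4 ^ k)"
    by (simp add: cbin_def del: binomial_Suc_Suc)
  then have "2 * (real k + 1) * cbin (Suc k) = 2 * (real (Suc k) * real ((2 * k + 2) choose Suc k)) / (4 * 4 ^ k)"
    by (simp add: field_simps del: binomial_Suc_Suc)
  also have "\<dots> = (2 * real k + 1) * cbin k"
    unfolding * by (simp add: cbin_def field_simps)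
  finally show ?thesis .
qed

lemma cbin_sums:
  assumes "\<bar>z\<bar> < (1::real)"
  shows "(\<lambda>k. cbin k * z ^ (2 * k)) sums (1 / sqrt (1 - z\<^sup>2))"
proof -
  have gb: "((- 1 / 2 :: real) gchoose k) * (- 1) ^ k = cbin k" for k
  proof (induction k)
    case (Suc k)
    have "real (Suc k) * ((- 1 / 2 :: real) gchoose Suc k) = (- 1 / 2 - real k) * ((- 1 / 2) gchoose k)"
      using gbinomial_mult_1[of "- 1 / 2 :: real" k] by (simp add: algebra_simps)
    then have "2 * real (Suc k) * (((- 1 / 2 :: real) gchoose Suc k) * (- 1) ^ Suc k)
        = (2 * real k + 1) * (((- 1 / 2 :: real) gchoose k) * (- 1) ^ k)"
      (is "?l = ?r")
    proof -
      assume h: "real (Suc k) * ((- 1 / 2 :: real) gchoose Suc k) = (- 1 / 2 - real k) * ((- 1 / 2) gchoose k)"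
      have "?l = - 2 * (real (Suc k) * ((- 1 / 2 :: real) gchoose Suc k)) * (- 1) ^ k"
        by simp
      also have "\<dots> = ?r"
        unfolding h by (simp add: algebra_simps)
      finally show ?thesis .
    qed
    also have "\<dots> = 2 * real (Suc k) * cbin (Suc k)"
      unfolding Suc.IH using cbin_Suc[of k] by (simp add: algebra_simps)
    finally show ?case
      by (rule mult_left_cancel[THEN iffD1, rotated]) simp
  qed simp
  have z: "\<bar>- (z\<^sup>2)\<bar> < 1"
    using assms by (simp add: abs_square_less_1)
  have pos: "0 < 1 - z\<^sup>2"
    using z by simp
  have "(\<lambda>k. ((- 1 / 2 :: real) gchoose k) * (- (z\<^sup>2)) ^ k) sums (1 + - (z\<^sup>2)) powr (- 1 / 2)"
    by (rule gen_binomial_real[OF z])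
  moreover have "(1 + - (z\<^sup>2)) powr (- 1 / 2) = 1 / sqrt (1 - z\<^sup>2)"
    using pos by (simp add: powr_minus_divide powr_half_sqrt)
  moreover have "((- 1 / 2 :: real) gchoose k) * (- (z\<^sup>2)) ^ k = cbin k * z ^ (2 * k)" for k
    by (simp add: power_mult power_minus[of "z\<^sup>2"] flip: gb)
  ultimately show ?thesis
    by simp
qed

lemma cbin_decreasing: "cbin (Suc k) \<le> cbin k"
proof -
  have "(2 * real k + 2) * cbin (Suc k) \<le> (2 * real k + 2) * cbin k"
    using cbin_Suc[of k] cbin_nonneg[of k] by (simp add: algebra_simps)
  then show ?thesis
    by (auto dest: mult_left_le_imp_le)
qed

lemma cbin_le_1: "cbin k \<le> 1"
  by (induction k) (auto intro: order_trans[OF cbin_decreasing])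

text \<open>
  Since \<open>cbin (Suc k) / cbin k = (2 * k + 1) / (2 * k + 2)\<close>, the induction step is the
  elementary inequality \<open>(2 * k + 1) * (2 * k + 3) \<le> (2 * k + 2)\<^sup>2\<close>.
\<close>

lemma cbin_square_le: "(cbin k)\<^sup>2 \<le> 1 / (2 * real k + 1)"
proof (induction k)
  case (Suc k)
  define a where "a = 2 * real k + 1"
  have a: "a > 0" by (simp add: a_def)
  have e: "(a + 1) * cbin (Suc k) = a * cbin k"
    using cbin_Suc[of k] by (simp add: a_def algebra_simps)
  have "(a + 1)\<^sup>2 * (cbin (Suc k))\<^sup>2 = a\<^sup>2 * (cbin k)\<^sup>2"
    using e by (metis power_mult_distrib)
  also have "\<dots> \<le> a\<^sup>2 * (1 / a)"
    using Suc by (intro mult_left_mono) (auto simp: a_def)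
  also have "\<dots> = a" using a by (simp add: power2_eq_square)
  finally have 1: "(a + 1)\<^sup>2 * (cbin (Suc k))\<^sup>2 \<le> a" .
  have "(a * (a + 2)) * (cbin (Suc k))\<^sup>2 \<le> (a + 1)\<^sup>2 * (cbin (Suc k))\<^sup>2"
    by (intro mult_right_mono) (auto simp: power2_eq_square algebra_simps)
  with 1 have "a * ((a + 2) * (cbin (Suc k))\<^sup>2) \<le> a * 1"
    by (simp add: mult_ac)
  then have "(a + 2) * (cbin (Suc k))\<^sup>2 \<le> 1"
    using a by simp
  then show ?case using a by (simp add: a_def field_simps)
qed simp

lemma cbin_tendsto_0: "cbin \<longlonglongrightarrow> 0"
proof -
  have "(\<lambda>k. 1 / (2 * real k + 1)) \<longlonglongrightarrow> 0" by real_asymp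
  then have "(\<lambda>k. (cbin k)\<^sup>2) \<longlonglongrightarrow> 0"
    by (rule tendsto_sandwich[rotated 3]) (auto simp: cbin_square_le)
  then show ?thesis
    by (simp add: tendsto_null_power flip: power2_eq_square)
qed

section \<open>The kernel of the integral representation\<close>

text \<open>
  For \<open>r = sin t\<close> the angle \<open>\<theta> = ang t\<close> is the one with \<open>cos \<theta> * (r + 1 / r) = 2\<close>. This is
  the relation under which \<open>exp (\<i> * x * \<theta>) * r ^ y\<close> is harmonic for the steps \<open>(\<plusminus>1, \<plusminus>1)\<close>.
\<close>

definition ang :: "real \<Rightarrow> real" where
  "ang t = pi / 2 - 2 * arctan (sin t)"

text \<open>
  On the axis \<open>y = 0\<close> the Fourier series of the boundary values is
  \<open>(1 - exp (2 * \<i> * \<theta>)) powr (- 1 / 2)\<close>, whose phase is \<open>\<pi> / 4 - \<theta> / 2\<close> and whose modulus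
  is \<open>(2 * sin \<theta>) powr (- 1 / 2)\<close>. The phase shifts \<open>x * \<theta>\<close> to the argument of the cosine
  below. The modulus is infinite at \<open>\<theta> = 0\<close>, but the Jacobian of \<open>\<theta> = ang t\<close> cancels this
  and leaves \<open>1 / sqrt (1 + (sin t)\<^sup>2)\<close> up to a constant.
\<close>

definition kern :: "int \<Rightarrow> real \<Rightarrow> real" where
  "kern x t = cos ((of_int x + 1 / 2) * ang t - pi / 4) / sqrt (1 + (sin t)\<^sup>2)"

text \<open>The conjugate kernel; it enters only through derivatives and shifts of the kernel.\<close>

definition cokern :: "int \<Rightarrow> real \<Rightarrow> real" where
  "cokern x t = sin ((of_int x + 1 / 2) * ang t - pi / 4) / sqrt (1 + (sin t)\<^sup>2)"

lemma one_plus_sin_sq [simp]: "0 < 1 + (sin (t::real))\<^sup>2" "1 + (sin (t::real))\<^sup>2 \<noteq> 0"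
  using zero_le_power2[of "sin t"] by (linarith, linarith)

lemma cos_ang: "cos (ang t) = 2 * sin t / (1 + (sin t)\<^sup>2)"
  using one_plus_sin_sq[of t]
  by (simp add: ang_def cos_diff sin_double sin_arctan cos_arctan)

lemma sin_ang: "sin (ang t) = (1 - (sin t)\<^sup>2) / (1 + (sin t)\<^sup>2)"
  using one_plus_sin_sq[of t]
  by (simp add: ang_def sin_diff cos_double sin_arctan cos_arctan power_divide diff_divide_distrib)

lemma kern_succ:
  "kern (x + 1) t = (2 * sin t * kern x t - (1 - (sin t)\<^sup>2) * cokern x t) / (1 + (sin t)\<^sup>2)"
proof -
  have "kern (x + 1) t = cos (((of_int x + 1 / 2) * ang t - pi / 4) + ang t) / sqrt (1 + (sin t)\<^sup>2)"
    by (simp add: kern_def algebra_simps)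
  also have "\<dots> = cos (ang t) * kern x t - sin (ang t) * cokern x t"
    by (simp only: cos_add kern_def cokern_def) (simp add: diff_divide_distrib mult_ac)
  finally show ?thesis
    by (simp only: cos_ang sin_ang times_divide_eq_left diff_divide_distrib[symmetric])
qed

lemma kern_pred:
  "kern (x - 1) t = (2 * sin t * kern x t + (1 - (sin t)\<^sup>2) * cokern x t) / (1 + (sin t)\<^sup>2)"
proof -
  have "kern (x - 1) t = cos (((of_int x + 1 / 2) * ang t - pi / 4) - ang t) / sqrt (1 + (sin t)\<^sup>2)"
    by (simp add: kern_def algebra_simps)
  also have "\<dots> = cos (ang t) * kern x t + sin (ang t) * cokern x t"
    unfolding cos_diff[of "(of_int x + 1 / 2) * ang t - pi / 4" "ang t"] kern_def cokern_def
    by (simp only: add_divide_distrib mult_ac times_divide_eq_right)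
  finally show ?thesis
    by (simp only: cos_ang sin_ang times_divide_eq_left add_divide_distrib[symmetric])
qed

text \<open>
  This is \<open>cos (\<alpha> + \<theta>) + cos (\<alpha> - \<theta>) = 2 * cos \<theta> * cos \<alpha>\<close>. It yields both harmonicity above
  the axis and, through the weight it produces at \<open>y = 0\<close>, the charges on the axis.
\<close>

lemma kern_neighbours:
  "(1 + (sin t)\<^sup>2) * (kern (x + 1) t + kern (x - 1) t) = 4 * sin t * kern x t"
  by (simp add: kern_succ kern_pred flip: add_divide_distrib)

lemma kern_0: "kern 0 t = 1 / (1 + (sin t)\<^sup>2)"
proof -
  have "kern 0 t = cos (arctan (sin t)) / sqrt (1 + (sin t)\<^sup>2)"
    by (simp add: kern_def ang_def algebra_simps add_divide_distrib diff_divide_distrib)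
  then show ?thesis
    by (simp add: cos_arctan)
qed

lemma kern_minus_1: "kern (- 1) t = sin t / (1 + (sin t)\<^sup>2)"
proof -
  have "kern (- 1) t = cos (arctan (sin t) - pi / 2) / sqrt (1 + (sin t)\<^sup>2)"
    by (simp add: kern_def ang_def algebra_simps add_divide_distrib diff_divide_distrib)
  then show ?thesis
    by (simp add: cos_diff sin_arctan)
qed

text \<open>
  For odd \<open>x\<close> the boundary terms in the integrations by parts below vanish at \<open>t = 0\<close>; at
  \<open>t = \<pi> / 2\<close> the factor \<open>cos t\<close> kills them.
\<close>

lemma kern_at_0:
  assumes "odd x"
  shows "kern x 0 = 0"
proof -
  from assms obtain k where x: "x = 2 * k + 1" by (elim oddE)
  have "kern x 0 = cos (of_int k * pi + pi / 2)"
    by (simp add: kern_def ang_def x algebra_simps add_divide_distrib)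
  then show ?thesis
    by (simp add: cos_add sin_times_pi_eq_0)
qed

lemma abs_kern_le_1: "\<bar>kern x t\<bar> \<le> 1"
proof -
  have "\<bar>cos ((of_int x + 1 / 2) * ang t - pi / 4)\<bar> \<le> 1" by simp
  also have "1 \<le> sqrt (1 + (sin t)\<^sup>2)" by simp
  finally show ?thesis
    by (simp add: kern_def)
qed

lemma continuous_on_kern [continuous_intros]: "continuous_on A (kern x)"
  unfolding kern_def[abs_def] ang_def by (intro continuous_intros) auto

lemma has_derivative_kern:
  "(kern x has_real_derivative
     cos t * ((2 * of_int x + 1) * cokern x t - sin t * kern x t) / (1 + (sin t)\<^sup>2)) (at t)"
proof -
  let ?A = "\<lambda>t. (of_int x + 1 / 2) * ang t - pi / 4"
  let ?u = "1 + (sin t)\<^sup>2"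
  have nz: "2 + 2 * (sin t)\<^sup>2 \<noteq> 0"
    using one_plus_sin_sq(1)[of t] by linarith
  have A: "(?A has_real_derivative - ((2 * of_int x + 1) * cos t / ?u)) (at t)"
    unfolding ang_def
    by (rule derivative_eq_intros refl | simp)+
       (use nz in \<open>simp add: divide_simps; simp add: algebra_simps\<close>)
  have u: "((\<lambda>t. sqrt (1 + (sin t)\<^sup>2)) has_real_derivative sin t * cos t / sqrt ?u) (at t)"
  proof (rule DERIV_cong[OF DERIV_chain2[OF DERIV_real_sqrt]])
    show "((\<lambda>t. 1 + (sin t)\<^sup>2) has_real_derivative 2 * sin t * cos t) (at t)"
      by (auto intro!: derivative_eq_intros)
  qed (simp_all add: divide_simps)
  have "((\<lambda>t. cos (?A t) / sqrt (1 + (sin t)\<^sup>2)) has_real_derivative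
      (sin (?A t) * ((2 * of_int x + 1) * cos t / ?u) * sqrt ?u - cos (?A t) * (sin t * cos t / sqrt ?u))
        / (sqrt ?u * sqrt ?u)) (at t)"
    by (rule DERIV_cong[OF DERIV_divide[OF DERIV_chain2[OF DERIV_cos A] u]]) (simp_all)
  moreover have "(sin (?A t) * ((2 * of_int x + 1) * cos t / ?u) * sqrt ?u - cos (?A t) * (sin t * cos t / sqrt ?u))
        / (sqrt ?u * sqrt ?u) = cos t * ((2 * of_int x + 1) * cokern x t - sin t * kern x t) / ?u"
  proof -
    define r where "r = sqrt ?u"
    have r: "r \<noteq> 0" "?u = r * r" by (simp_all add: r_def)
    show ?thesis
      unfolding kern_def cokern_def r_def[symmetric] unfolding r(2) using r(1)
      by (simp add: field_simps)
  qed
  ultimately show ?thesis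
    unfolding kern_def[abs_def] by simp
qed

text \<open>
  Integrating this total derivative gives a two-term recurrence for the integrals of
  \<open>kern x\<close> over even \<open>x\<close>, that is, for the values on the axis.
\<close>

lemma has_derivative_cos_kern:
  "((\<lambda>t. cos t * kern x t) has_real_derivative
     of_int x * kern (x - 1) t - of_int (x + 1) * kern (x + 1) t) (at t)"
proof -
  let ?u = "1 + (sin t)\<^sup>2"
  define s k c where "s = sin t" and "k = kern x t" and "c = cokern x t"
  have u: "1 + s\<^sup>2 \<noteq> 0" by (simp add: s_def)
  have c2: "(cos t)\<^sup>2 = 1 - s\<^sup>2" by (simp add: s_def cos_squared_eq)
  have "((\<lambda>t. cos t * kern x t) has_real_derivative
      - s * k + (cos t)\<^sup>2 * ((2 * of_int x + 1) * c - s * k) / (1 + s\<^sup>2)) (at t)"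
    unfolding s_def k_def c_def
    by (rule derivative_eq_intros refl has_derivative_kern | simp)+ (simp add: power2_eq_square)
  moreover have "- s * k + (cos t)\<^sup>2 * ((2 * of_int x + 1) * c - s * k) / (1 + s\<^sup>2)
      = of_int x * kern (x - 1) t - of_int (x + 1) * kern (x + 1) t"
    unfolding c2 kern_succ kern_pred s_def[symmetric] k_def[symmetric] c_def[symmetric]
    using u by (simp add: divide_simps) (simp add: algebra_simps power2_eq_square)
  ultimately show ?thesis by simp
qed

text \<open>
  This is \<open>sin (ang t)\<close>. The Laplacian of \<open>sin t ^ y * kern x t\<close>, taken at \<open>y = 0\<close> with the
  two upper neighbours only, multiplies the kernel by twice this weight.
\<close>

definition charge_weight :: "real \<Rightarrow> real" where
  "charge_weight t = (1 - (sin t)\<^sup>2) / (1 + (sin t)\<^sup>2)"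

lemma continuous_on_charge_weight [continuous_intros]: "continuous_on A charge_weight"
  unfolding charge_weight_def[abs_def] by (intro continuous_intros) auto

text \<open>
  The analogue of the previous total derivative with the weight inserted; it gives the
  two-term recurrence for the charges.
\<close>

lemma has_derivative_charge_weight_cos_kern:
  "((\<lambda>t. charge_weight t * (cos t * kern x t)) has_real_derivative
     of_int (x - 1) * (charge_weight t * kern (x - 1) t)
       - of_int (x + 2) * (charge_weight t * kern (x + 1) t)) (at t)"
proof -
  let ?u = "1 + (sin t)\<^sup>2"
  let ?D = "of_int x * kern (x - 1) t - of_int (x + 1) * kern (x + 1) t"
  have "(charge_weight has_real_derivative - (4 * sin t * cos t / ?u\<^sup>2)) (at t)"
    unfolding charge_weight_def[abs_def]
    by (rule derivative_eq_intros refl | simp)+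
       (simp add: divide_simps; simp add: algebra_simps power2_eq_square)
  from DERIV_mult[OF this has_derivative_cos_kern[of x t]]
  have "((\<lambda>t. charge_weight t * (cos t * kern x t)) has_real_derivative
      - (4 * sin t * cos t / ?u\<^sup>2) * (cos t * kern x t) + ?D * charge_weight t) (at t)" .
  moreover have "(4 * sin t * cos t / ?u\<^sup>2) * (cos t * kern x t)
      = charge_weight t * (kern (x + 1) t + kern (x - 1) t)"
  proof -
    have "(4 * sin t * cos t / ?u\<^sup>2) * (cos t * kern x t) = (cos t)\<^sup>2 / ?u * ((4 * sin t * kern x t) / ?u)"
      by (simp add: power2_eq_square)
    also have "(4 * sin t * kern x t) / ?u = kern (x + 1) t + kern (x - 1) t"
      by (simp flip: kern_neighbours)
    finally show ?thesis
      by (simp add: charge_weight_def cos_squared_eq)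
  qed
  ultimately show ?thesis
    by (simp add: algebra_simps)
qed

text \<open>
  The recurrence for the charges leaves their overall scale open; this derivative fixes it
  through the value at the origin.
\<close>

lemma has_derivative_sin_cos_over:
  "((\<lambda>t. sin t * cos t / (1 + (sin t)\<^sup>2)) has_real_derivative 2 * (charge_weight t * kern 0 t) - kern 0 t) (at t)"
proof -
  define s where "s = sin t"
  have u: "1 + s\<^sup>2 \<noteq> 0" by (simp add: s_def)
  have c2: "(cos t)\<^sup>2 = 1 - s\<^sup>2" by (simp add: s_def cos_squared_eq)
  have "((\<lambda>t. sin t * cos t / (1 + (sin t)\<^sup>2)) has_real_derivative
     (((cos t)\<^sup>2 - s\<^sup>2) * (1 + s\<^sup>2) - 2 * s\<^sup>2 * (cos t)\<^sup>2) / (1 + s\<^sup>2)\<^sup>2) (at t)"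
    unfolding s_def
    by (rule derivative_eq_intros refl | simp)+ (simp add: divide_simps; simp add: algebra_simps power2_eq_square)
  moreover have "(((cos t)\<^sup>2 - s\<^sup>2) * (1 + s\<^sup>2) - 2 * s\<^sup>2 * (cos t)\<^sup>2) / (1 + s\<^sup>2)\<^sup>2
      = 2 * (charge_weight t * kern 0 t) - kern 0 t"
    unfolding c2 charge_weight_def kern_0 s_def[symmetric]
    using u by (simp add: divide_simps) (simp add: algebra_simps power2_eq_square)
  ultimately show ?thesis by simp
qed

section \<open>Values and relations of the integral\<close>

text \<open>The constant makes the value of the Green's function at the origin equal to \<open>1\<close>.\<close>

definition slit_integral :: "(real \<Rightarrow> real) \<Rightarrow> real" where
  "slit_integral f = 2 * sqrt 2 / pi * integral {0..pi / 2} f"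

definition slit_green :: "int \<Rightarrow> int \<Rightarrow> real" where
  "slit_green x y = slit_integral (\<lambda>t. sin t ^ nat y * kern x t)"

lemma slit_integral_add:
  assumes "continuous_on {0..pi / 2} f" "continuous_on {0..pi / 2} g"
  shows "slit_integral (\<lambda>t. f t + g t) = slit_integral f + slit_integral g"
  using assms unfolding slit_integral_def
  by (subst integral_add) (auto intro: integrable_continuous_interval simp: distrib_left)

lemma slit_integral_cmult: "slit_integral (\<lambda>t. c * f t) = c * slit_integral f"
  by (simp add: slit_integral_def)

lemma slit_integral_diff:
  assumes "continuous_on {0..pi / 2} f" "continuous_on {0..pi / 2} g"
  shows "slit_integral (\<lambda>t. f t - g t) = slit_integral f - slit_integral g"
  using assms unfolding slit_integral_def
  by (subst integral_diff) (auto intro: integrable_continuous_interval simp: right_diff_distrib)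

lemma slit_integral_derivative:
  assumes "\<And>t. (F has_real_derivative f t) (at t)"
  shows "slit_integral f = 2 * sqrt 2 / pi * (F (pi / 2) - F 0)"
proof -
  have "(f has_integral F (pi / 2) - F 0) {0..pi / 2}"
    by (rule fundamental_theorem_of_calculus)
       (auto intro!: has_field_derivative_at_within[OF assms] simp flip: has_real_derivative_iff_has_vector_derivative)
  then show ?thesis
    by (simp add: slit_integral_def integral_unique)
qed

text \<open>
  With \<open>r = sin t\<close>, adding the upper and lower neighbours gives the factor
  \<open>r ^ (y - 1) * (1 + r\<^sup>2)\<close>, and adding left and right ones then gives \<open>4 * r / (1 + r\<^sup>2)\<close>.
\<close>

lemma slit_green_harmonic:
  assumes "1 \<le> y"
  shows "4 * slit_green x y = slit_green (x + 1) (y + 1) + slit_green (x + 1) (y - 1)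
    + slit_green (x - 1) (y + 1) + slit_green (x - 1) (y - 1)"
proof -
  define n where "n = nat (y - 1)"
  have n: "nat y = Suc n" "nat (y + 1) = Suc (Suc n)" "nat (y - 1) = n"
    using assms by (auto simp: n_def)
  have "4 * (sin t ^ Suc n * kern x t)
      = sin t ^ Suc (Suc n) * kern (x + 1) t + sin t ^ n * kern (x + 1) t
      + sin t ^ Suc (Suc n) * kern (x - 1) t + sin t ^ n * kern (x - 1) t" for t
  proof -
    have "4 * (sin t ^ Suc n * kern x t) = sin t ^ n * (4 * sin t * kern x t)"
      by simp
    then show ?thesis
      unfolding kern_neighbours[symmetric] by (simp add: algebra_simps power2_eq_square)
  qed
  then have "4 * slit_green x y = slit_integral (\<lambda>t. sin t ^ Suc (Suc n) * kern (x + 1) t + sin t ^ n * kern (x + 1) t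
      + sin t ^ Suc (Suc n) * kern (x - 1) t + sin t ^ n * kern (x - 1) t)"
    unfolding slit_green_def n by (subst slit_integral_cmult[symmetric]) simp
  also have "\<dots> = slit_green (x + 1) (y + 1) + slit_green (x + 1) (y - 1)
    + slit_green (x - 1) (y + 1) + slit_green (x - 1) (y - 1)"
    unfolding slit_green_def n by (simp only: slit_integral_add continuous_intros)
  finally show ?thesis .
qed

text \<open>The integrands agree, because \<open>kern (- 1) t = sin t * kern 0 t\<close>.\<close>

lemma slit_green_adjacent:
  assumes "0 < y"
  shows "slit_green 0 y = slit_green (- 1) (y - 1)"
proof -
  have "nat y = Suc (nat (y - 1))" using assms by simp
  then show ?thesis
    by (simp add: slit_green_def kern_0 kern_minus_1 mult_ac)
qed

lemma slit_green_axis_step: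
  assumes "odd x"
  shows "of_int (x + 1) * slit_green (x + 1) 0 = of_int x * slit_green (x - 1) 0"
proof -
  have "slit_integral (\<lambda>t. of_int x * kern (x - 1) t - of_int (x + 1) * kern (x + 1) t) = 0"
    using slit_integral_derivative[OF has_derivative_cos_kern[of x]] kern_at_0[OF assms] by simp
  then show ?thesis
    by (subst (asm) slit_integral_diff) (auto intro!: continuous_intros simp: slit_green_def slit_integral_cmult)
qed

text \<open>
  The integral of \<open>1 / (1 + (sin t)\<^sup>2)\<close>. The usual antiderivative
  \<open>arctan (sqrt 2 * tan t) / sqrt 2\<close> is undefined at \<open>t = \<pi> / 2\<close>. Subtracting \<open>t\<close> from the
  arctangent by the addition theorem gives one that is smooth on the whole interval.
\<close>

lemma slit_green_origin: "slit_green 0 0 = 1"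
proof -
  let ?c = "\<lambda>t::real. (cos t)\<^sup>2 + sqrt 2 * (sin t)\<^sup>2"
  let ?F = "\<lambda>t. (t + arctan ((sqrt 2 - 1) * (sin t * cos t) / ?c t)) / sqrt 2"
  have "(?F has_real_derivative kern 0 t) (at t)" for t
  proof -
    define s c q where "s = sin t" and "c = cos t" and "q = sqrt (2::real)"
    define S d where "S = s\<^sup>2" and "d = c\<^sup>2 + q * s\<^sup>2"
    have q: "q\<^sup>2 = 2" "1 < q" by (auto simp: q_def)
    have c2: "c\<^sup>2 = 1 - S" by (simp add: s_def c_def S_def cos_squared_eq)
    have S: "0 \<le> S" by (simp add: S_def)
    have d': "d = 1 + (q - 1) * S"
      by (simp add: d_def c2 S_def[symmetric] algebra_simps)
    have d: "d > 0" using q(2) S by (simp add: d' add_pos_nonneg)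
    define g where "g = (\<lambda>t. (sqrt 2 - 1) * (sin t * cos t) / ((cos t)\<^sup>2 + sqrt 2 * (sin t)\<^sup>2))"
    have gt: "g t = (q - 1) * (s * c) / d"
      by (simp add: g_def d_def s_def c_def q_def)
    have gt2: "(g t)\<^sup>2 = (q - 1)\<^sup>2 * (S * (1 - S)) / d\<^sup>2"
      by (simp add: gt power_mult_distrib power_divide S_def c2)
    \<comment> \<open>With \<open>(cos t)\<^sup>2 = 1 - S\<close> and \<open>q\<^sup>2 = 2\<close> the denominator of the derivative simplifies to \<open>1 + S\<close>.\<close>
    have e1: "d\<^sup>2 + (q - 1)\<^sup>2 * (S * (1 - S)) = 1 + S"
    proof -
      have "d\<^sup>2 + (q - 1)\<^sup>2 * (S * (1 - S)) = 1 + (q\<^sup>2 - 1) * S"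
        unfolding d' by (simp add: power2_eq_square algebra_simps)
      then show ?thesis by (simp add: q)
    qed
    have e2: "(q - 1) * (1 - 2 * S) * d - (q - 1) * (2 * (q - 1)) * (S * (1 - S)) = q - 1 - S"
    proof -
      have "(q - 1) * (1 - 2 * S) * d - (q - 1) * (2 * (q - 1)) * (S * (1 - S)) = q - 1 - (q\<^sup>2 - 1) * S"
        unfolding d' by (simp add: power2_eq_square algebra_simps)
      then show ?thesis by (simp add: q)
    qed
    have sc: "s * c * (s * c) = S * (1 - S)"
      by (simp only: c2[symmetric]) (simp add: S_def power2_eq_square)
    have D: "(g has_real_derivative ((q - 1) * (c\<^sup>2 - s\<^sup>2) * d - (q - 1) * (s * c) * (2 * (q - 1) * (s * c))) / (d * d)) (at t)"
      unfolding g_def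
    proof (rule DERIV_cong[OF DERIV_divide])
      show "((\<lambda>t. (sqrt 2 - 1) * (sin t * cos t)) has_real_derivative (q - 1) * (c\<^sup>2 - s\<^sup>2)) (at t)"
        by (auto intro!: derivative_eq_intros simp: q_def c_def s_def power2_eq_square algebra_simps)
      show "((\<lambda>t. (cos t)\<^sup>2 + sqrt 2 * (sin t)\<^sup>2) has_real_derivative 2 * (q - 1) * (s * c)) (at t)"
        by (auto intro!: derivative_eq_intros simp: q_def c_def s_def power2_eq_square algebra_simps)
      show "(cos t)\<^sup>2 + sqrt 2 * (sin t)\<^sup>2 \<noteq> 0"
        using d by (simp add: d_def c_def s_def q_def)
    qed (simp add: q_def c_def s_def d_def)
    have "((\<lambda>t. (t + arctan (g t)) / sqrt 2) has_real_derivative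
        (1 + inverse (1 + (g t)\<^sup>2) * (((q - 1) * (c\<^sup>2 - s\<^sup>2) * d - (q - 1) * (s * c) * (2 * (q - 1) * (s * c))) / (d * d))) / q) (at t)"
      unfolding q_def[symmetric]
      by (rule DERIV_cong[OF DERIV_cdivide[OF DERIV_add[OF DERIV_ident DERIV_chain2[OF DERIV_arctan D]]]]) simp
    moreover have "(1 + inverse (1 + (g t)\<^sup>2) * (((q - 1) * (c\<^sup>2 - s\<^sup>2) * d - (q - 1) * (s * c) * (2 * (q - 1) * (s * c))) / (d * d))) / q
        = kern 0 t"
    proof -
      have N: "(q - 1) * (c\<^sup>2 - s\<^sup>2) * d - (q - 1) * (s * c) * (2 * (q - 1) * (s * c)) = q - 1 - S"
        unfolding e2[symmetric] sc[symmetric] c2 S_def[symmetric] by (simp add: algebra_simps)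
      have "1 + (g t)\<^sup>2 = (1 + S) / d\<^sup>2"
        unfolding gt2 e1[symmetric] using d by (simp add: add_divide_distrib)
      then have "inverse (1 + (g t)\<^sup>2) = d\<^sup>2 / (1 + S)" by simp
      then have "(1 + inverse (1 + (g t)\<^sup>2) * ((q - 1 - S) / (d * d))) / q = (1 + (q - 1 - S) / (1 + S)) / q"
        using d by (simp add: power2_eq_square)
      also have "\<dots> = 1 / (1 + S)"
        using S q(2) by (simp add: divide_simps)
      finally show ?thesis
        unfolding N kern_0 by (simp add: S_def s_def)
    qed
    ultimately show ?thesis
      by (simp add: g_def)
  qed
  from slit_integral_derivative[OF this] show ?thesis
    by (simp add: slit_green_def)
qed

text \<open>
  The recurrence runs in both directions from the origin. To the right it is that of
  \<open>cbin\<close>; to the left its coefficient \<open>x + 1\<close> vanishes at once, at \<open>x = - 1\<close>, and this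
  produces the zeros on the slit.
\<close>

lemma slit_green_axis:
  "slit_green (2 * int k) 0 = cbin k" "slit_green (- 2 * int (Suc k)) 0 = 0"
proof -
  show "slit_green (2 * int k) 0 = cbin k"
  proof (induction k)
    case (Suc k)
    have "2 * (real k + 1) * slit_green (2 * int (Suc k)) 0 = (2 * real k + 1) * cbin k"
      using slit_green_axis_step[of "2 * int k + 1"] Suc by (simp add: algebra_simps)
    then have "2 * (real k + 1) * slit_green (2 * int (Suc k)) 0 = 2 * (real k + 1) * cbin (Suc k)"
      by (simp only: cbin_Suc)
    then show ?case by (rule mult_left_cancel[THEN iffD1, rotated]) simp
  qed (simp add: slit_green_origin)
  show "slit_green (- 2 * int (Suc k)) 0 = 0"
  proof (induction k)
    case 0
    show ?case using slit_green_axis_step[of "-1"] by simp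
  next
    case (Suc k)
    have "of_int (- 2 * int (Suc k) - 1) * slit_green (- 2 * int (Suc (Suc k))) 0 = 0"
      using slit_green_axis_step[of "- 2 * int (Suc k) - 1"] Suc by (simp add: algebra_simps)
    moreover have "of_int (- 2 * int (Suc k) - 1) \<noteq> (0::real)"
      by (simp only: of_int_eq_0_iff)
    ultimately show ?case by (metis mult_eq_0_iff)
  qed
qed

text \<open>
  Twice the value on the axis minus the upper neighbours: the source that the reflected
  function has at \<open>(x, 0)\<close>. It is carried by the slit and the origin.
\<close>

definition slit_charge :: "int \<Rightarrow> real" where
  "slit_charge x = 2 * slit_green x 0 - slit_green (x - 1) 1 - slit_green (x + 1) 1"

lemma slit_charge_eq: "slit_charge x = 2 * slit_integral (\<lambda>t. charge_weight t * kern x t)"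
proof -
  have "2 * (charge_weight t * kern x t) = 2 * kern x t - sin t * kern (x - 1) t - sin t * kern (x + 1) t" for t
  proof -
    have "sin t * kern (x - 1) t + sin t * kern (x + 1) t = sin t * (4 * sin t * kern x t) / (1 + (sin t)\<^sup>2)"
    proof -
      have "sin t * ((1 + (sin t)\<^sup>2) * K) / (1 + (sin t)\<^sup>2) = sin t * K" for K by simp
      then show ?thesis
        by (simp only: kern_neighbours[symmetric]) (simp only: distrib_left add.commute)
    qed
    moreover have "2 * (charge_weight t * kern x t) = 2 * kern x t - sin t * (4 * sin t * kern x t) / (1 + (sin t)\<^sup>2)"
      unfolding charge_weight_def using one_plus_sin_sq[of t]
      by (simp add: divide_simps) (simp add: algebra_simps power2_eq_square)
    ultimately show ?thesis by linarith
  qed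
  then have "2 * slit_integral (\<lambda>t. charge_weight t * kern x t)
      = slit_integral (\<lambda>t. 2 * kern x t - sin t * kern (x - 1) t - sin t * kern (x + 1) t)"
    by (subst slit_integral_cmult[symmetric]) simp
  also have "\<dots> = slit_charge x"
    by (subst slit_integral_diff slit_integral_diff | intro continuous_intros)+
       (simp add: slit_charge_def slit_green_def slit_integral_cmult)
  finally show ?thesis by simp
qed

lemma slit_charge_step:
  assumes "odd x"
  shows "of_int (x + 2) * slit_charge (x + 1) = of_int (x - 1) * slit_charge (x - 1)"
proof -
  have "slit_integral (\<lambda>t. of_int (x - 1) * (charge_weight t * kern (x - 1) t)
       - of_int (x + 2) * (charge_weight t * kern (x + 1) t)) = 0"
    using slit_integral_derivative[OF has_derivative_charge_weight_cos_kern[of x]] kern_at_0[OF assms] by simp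
  then show ?thesis
    by (subst (asm) slit_integral_diff) (auto intro!: continuous_intros simp: slit_charge_eq slit_integral_cmult simp del: of_int_add of_int_diff)
qed

lemma slit_charge_origin: "slit_charge 0 = 1"
proof -
  have "slit_integral (\<lambda>t. 2 * (charge_weight t * kern 0 t) - kern 0 t) = 0"
    using slit_integral_derivative[OF has_derivative_sin_cos_over] by simp
  then have "2 * slit_integral (\<lambda>t. charge_weight t * kern 0 t) - slit_integral (kern 0) = 0"
    by (subst (asm) slit_integral_diff) (auto intro!: continuous_intros simp: slit_integral_cmult)
  then show ?thesis
    using slit_green_origin by (simp add: slit_charge_eq slit_green_def)
qed

text \<open>
  The recurrence has the factor \<open>x - 1\<close>, which vanishes at \<open>x = 1\<close>, so there is no charge
  to the right of the origin. On the slit it generates the coefficients of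
  \<open>(1 - w) * (1 - w) powr (- 1 / 2) = sqrt (1 - w)\<close>.
\<close>

lemma slit_charge_axis:
  "slit_charge (2 * int (Suc k)) = 0" "slit_charge (- 2 * int (Suc k)) = cbin (Suc k) - cbin k"
proof -
  show "slit_charge (2 * int (Suc k)) = 0"
  proof (induction k)
    case 0
    show ?case using slit_charge_step[of 1] by simp
  next
    case (Suc k)
    have "of_int (2 * int (Suc k) + 3) * slit_charge (2 * int (Suc (Suc k))) = 0"
      using slit_charge_step[of "2 * int (Suc k) + 1"] Suc by (simp add: algebra_simps)
    moreover have "of_int (2 * int (Suc k) + 3) \<noteq> (0::real)"
      by (simp only: of_int_eq_0_iff)
    ultimately show ?case by (metis mult_eq_0_iff)
  qed
  show "slit_charge (- 2 * int (Suc k)) = cbin (Suc k) - cbin k"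
  proof (induction k)
    case 0
    show ?case using slit_charge_step[of "-1"] cbin_Suc[of 0] by (simp add: slit_charge_origin)
  next
    case (Suc k)
    have s: "2 * (real k + 2) * slit_charge (- 2 * int (Suc (Suc k))) = (2 * real k + 1) * (cbin (Suc k) - cbin k)"
    proof -
      have "2 * (real k + 2) * slit_charge (- 2 * int (Suc (Suc k))) = (2 * real k + 1) * slit_charge (- 2 * int (Suc k))"
        using slit_charge_step[of "- 2 * int (Suc k) - 1"] by (simp add: algebra_simps)
      then show ?thesis by (simp only: Suc.IH)
    qed
    have "2 * (real k + 2) * (cbin (Suc (Suc k)) - cbin (Suc k)) = (2 * real k + 1) * (cbin (Suc k) - cbin k)"
      using cbin_Suc[of k] cbin_Suc[of "Suc k"] by (simp add: algebra_simps)
    with s have "2 * (real k + 2) * slit_charge (- 2 * int (Suc (Suc k)))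
        = 2 * (real k + 2) * (cbin (Suc (Suc k)) - cbin (Suc k))" by simp
    then show ?case by (rule mult_left_cancel[THEN iffD1, rotated]) simp
  qed
qed

text \<open>Wallis' integral.\<close>

lemma slit_integral_sin_power_even: "slit_integral (\<lambda>t. sin t ^ (2 * k)) = sqrt 2 * cbin k"
proof (induction k)
  case 0
  show ?case by (simp add: slit_integral_def)
next
  case (Suc k)
  have "((\<lambda>t. sin t ^ (2 * k + 1) * cos t) has_real_derivative
      (2 * real k + 1) * sin t ^ (2 * k) - (2 * real k + 2) * sin t ^ (2 * Suc k)) (at t)" for t :: real
  proof (rule DERIV_cong[OF DERIV_mult])
    show "((\<lambda>t. sin t ^ (2 * k + 1)) has_real_derivative (2 * real k + 1) * sin t ^ (2 * k) * cos t) (at t)"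
      using DERIV_power_Suc[OF DERIV_sin[of t], of "2 * k"] by (simp add: algebra_simps)
    show "(2 * real k + 1) * sin t ^ (2 * k) * cos t * cos t + - sin t * sin t ^ (2 * k + 1)
        = (2 * real k + 1) * sin t ^ (2 * k) - (2 * real k + 2) * sin t ^ (2 * Suc k)"
    proof -
      have "(2 * real k + 1) * sin t ^ (2 * k) * cos t * cos t = (2 * real k + 1) * sin t ^ (2 * k) * (1 - (sin t)\<^sup>2)"
        unfolding cos_squared_eq[symmetric] by (simp add: power2_eq_square)
      then show ?thesis by (simp add: algebra_simps power2_eq_square)
    qed
  qed (rule DERIV_cos)
  from slit_integral_derivative[OF this]
  have "slit_integral (\<lambda>t. (2 * real k + 1) * sin t ^ (2 * k) - (2 * real k + 2) * sin t ^ (2 * Suc k)) = 0"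
    by simp
  then have "(2 * real k + 2) * slit_integral (\<lambda>t. sin t ^ (2 * Suc k)) = (2 * real k + 1) * slit_integral (\<lambda>t. sin t ^ (2 * k))"
    by (subst (asm) slit_integral_diff) (auto intro!: continuous_intros simp: slit_integral_cmult simp del: mult_Suc_right)
  also have "\<dots> = sqrt 2 * ((2 * real k + 1) * cbin k)"
    using Suc by simp
  also have "\<dots> = (2 * real k + 2) * (sqrt 2 * cbin (Suc k))"
    by (simp only: cbin_Suc[symmetric]) simp
  finally show ?case by (rule mult_left_cancel[THEN iffD1, rotated]) simp
qed

text \<open>
  Here \<open>1 + (sin t)\<^sup>2\<close> cancels against the denominator of \<open>kern 0 t\<close>, which leaves Wallis'
  integral.
\<close>

lemma slit_green_vertical:
  "slit_green 0 (2 * int k) + slit_green 0 (2 * int k + 2) = sqrt 2 * cbin k"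
proof -
  have n: "nat (2 * int k) = 2 * k" "nat (2 * int k + 2) = 2 * k + 2" by auto
  have "slit_green 0 (2 * int k) + slit_green 0 (2 * int k + 2)
      = slit_integral (\<lambda>t. sin t ^ (2 * k) * kern 0 t + sin t ^ (2 * k + 2) * kern 0 t)"
    unfolding slit_green_def n by (subst slit_integral_add) (auto intro!: continuous_intros)
  also have "\<dots> = slit_integral (\<lambda>t. sin t ^ (2 * k))"
  proof -
    have "sin t ^ (2 * k) * kern 0 t + sin t ^ (2 * k + 2) * kern 0 t = sin t ^ (2 * k)" for t
      using one_plus_sin_sq[of t]
      by (simp add: kern_0 divide_simps) (simp add: algebra_simps power2_eq_square)
    then show ?thesis by simp
  qed
  finally show ?thesis by (simp add: slit_integral_sin_power_even)
qed

text \<open>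
  The bound does not involve \<open>x\<close> and decays in \<open>y\<close>. Decay in the one direction \<open>y\<close> is
  enough for the identification of the Green's function below.
\<close>

lemma abs_slit_green_le: "\<bar>slit_green x y\<bar> \<le> sqrt 2 * cbin (nat y div 2)"
proof -
  have "norm (integral {0..pi / 2} (\<lambda>t. sin t ^ nat y * kern x t))
      \<le> integral {0..pi / 2} (\<lambda>t. sin t ^ (2 * (nat y div 2)))"
  proof (rule integral_norm_bound_integral)
    fix t assume t: "t \<in> {0..pi / 2}"
    then have s: "0 \<le> sin t" by (intro sin_ge_zero) auto
    have "norm (sin t ^ nat y * kern x t) \<le> sin t ^ nat y * 1"
      unfolding real_norm_def abs_mult using s abs_kern_le_1[of x t]
      by (intro mult_mono) auto
    also have "\<dots> \<le> sin t ^ (2 * (nat y div 2))"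
      using s by (simp add: power_decreasing)
    finally show "norm (sin t ^ nat y * kern x t) \<le> sin t ^ (2 * (nat y div 2))" .
  qed (auto intro!: integrable_continuous_interval continuous_intros)
  then have "\<bar>slit_green x y\<bar> \<le> slit_integral (\<lambda>t. sin t ^ (2 * (nat y div 2)))"
    unfolding slit_green_def slit_integral_def abs_mult by (intro mult_mono) auto
  then show ?thesis by (simp only: slit_integral_sin_power_even)
qed

section \<open>First-step analysis of the walk\<close>

definition jump_law :: "((int \<times> int) \<times> real) measure" where
  "jump_law = measure_pmf (pmf_of_set unit_steps)
       \<Otimes>\<^sub>M density lborel (\<lambda>t. ennreal (exponential_density 4 t))"

lemma prob_space_jump_law: "prob_space jump_law"
proof -
  interpret A: prob_space "measure_pmf (pmf_of_set unit_steps)" by (rule prob_space_measure_pmf)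
  interpret B: prob_space "density lborel (\<lambda>t. ennreal (exponential_density 4 t))"
    using prob_space_exponential_density[of 4] by simp
  interpret pair_prob_space "measure_pmf (pmf_of_set unit_steps)" "density lborel (\<lambda>t. ennreal (exponential_density 4 t))" ..
  show ?thesis unfolding jump_law_def by (rule prob_space_axioms)
qed

lemma sequence_space_jump_law: "sequence_space jump_law"
proof -
  interpret prob_space jump_law by (rule prob_space_jump_law)
  show ?thesis by unfold_locales
qed

lemma walk_space_eq: "walk_space = (\<Pi>\<^sub>M i\<in>UNIV. jump_law)"
  by (simp add: walk_space_def jump_law_def)

lemma nn_integral_jump_law_step:
  "(\<integral>\<^sup>+ s. g (fst s) \<partial>jump_law) = (\<Sum>e\<in>unit_steps. g e) / 4"
proof -
  interpret B: prob_space "density lborel (\<lambda>t. ennreal (exponential_density 4 t))"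
    using prob_space_exponential_density[of 4] by simp
  have "(\<integral>\<^sup>+ s. g (fst s) \<partial>jump_law) = (\<integral>\<^sup>+ e. g e \<partial>measure_pmf (pmf_of_set unit_steps))"
    unfolding jump_law_def
    by (subst B.nn_integral_fst[symmetric]) (auto simp: B.emeasure_space_1[simplified])
  also have "\<dots> = (\<Sum>e\<in>unit_steps. g e) / 4"
    by (subst nn_integral_pmf_of_set) (auto simp: unit_steps_def)
  finally show ?thesis .
qed

lemma nn_integral_jump_law_time:
  "(\<integral>\<^sup>+ s. ennreal (snd s) \<partial>jump_law) = ennreal (1 / 4)"
proof -
  interpret B: prob_space "density lborel (\<lambda>t. ennreal (exponential_density 4 t))"
    using prob_space_exponential_density[of 4] by simp
  have "(\<integral>\<^sup>+ s. ennreal (snd s) \<partial>jump_law)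
      = (\<integral>\<^sup>+ e. (\<integral>\<^sup>+ t. ennreal t \<partial>density lborel (\<lambda>t. ennreal (exponential_density 4 t)))
          \<partial>measure_pmf (pmf_of_set unit_steps))"
    unfolding jump_law_def by (subst B.nn_integral_fst[symmetric]) auto
  also have "\<dots> = (\<integral>\<^sup>+ t. ennreal t \<partial>density lborel (\<lambda>t. ennreal (exponential_density 4 t)))"
    by simp
  also have "\<dots> = (\<integral>\<^sup>+ t. ennreal (erlang_density 0 4 t * t ^ 1) \<partial>lborel)"
    by (subst nn_integral_density)
       (auto simp: ennreal_mult' exponential_density_nonneg intro!: nn_integral_cong)
  also have "\<dots> = ennreal (1 / 4)"
    by (subst nn_integral_erlang_ith_moment) auto
  finally show ?thesis .
qed

text \<open>The \<open>n\<close>-th summand of \<open>time_spent\<close>.\<close>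

definition visit_time :: "(int \<times> int) set \<Rightarrow> int \<times> int \<Rightarrow> int \<times> int \<Rightarrow> nat \<Rightarrow> (nat \<Rightarrow> (int \<times> int) \<times> real) \<Rightarrow> ennreal" where
  "visit_time D u v n \<omega> = (if walk_pos u \<omega> n = v \<and> (\<forall>k\<le>n. walk_pos u \<omega> k \<notin> D)
           then ennreal (snd (\<omega> n)) else 0)"

lemma walk_pos_0 [simp]: "walk_pos u \<omega> 0 = u"
  by (simp add: walk_pos_def)

lemma walk_pos_case_nat: "walk_pos u (case_nat s \<omega>) (Suc n) = walk_pos (u + fst s) \<omega> n"
  unfolding walk_pos_def by (simp add: sum.lessThan_Suc_shift del: sum.lessThan_Suc)

text \<open>The Markov property at the first jump, on the level of paths.\<close>

lemma visit_time_case_nat: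
  "visit_time D u v (Suc n) (case_nat s \<omega>) = (if u \<in> D then 0 else visit_time D (u + fst s) v n \<omega>)"
proof -
  have "(\<forall>k\<le>Suc n. walk_pos u (case_nat s \<omega>) k \<notin> D) \<longleftrightarrow>
      u \<notin> D \<and> (\<forall>k\<le>n. walk_pos u (case_nat s \<omega>) (Suc k) \<notin> D)"
    by (metis Suc_le_mono le0 not0_implies_Suc walk_pos_0)
  then show ?thesis
    unfolding visit_time_def walk_pos_case_nat by auto
qed

lemma measurable_walk_pos [measurable]:
  "(\<lambda>\<omega>. walk_pos u \<omega> n) \<in> walk_space \<rightarrow>\<^sub>M count_space UNIV"
proof (induction n arbitrary: u)
  case (Suc n)
  have step: "(\<lambda>\<omega>. fst (\<omega> n)) \<in> walk_space \<rightarrow>\<^sub>M count_space UNIV"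
  proof -
    have "fst \<in> jump_law \<rightarrow>\<^sub>M measure_pmf (pmf_of_set unit_steps)"
      unfolding jump_law_def by (rule measurable_fst)
    then have "fst \<in> jump_law \<rightarrow>\<^sub>M count_space UNIV"
      by (simp cong: measurable_cong_sets)
    then show ?thesis
      unfolding walk_space_eq by measurable
  qed
  have "(\<lambda>\<omega>. walk_pos u \<omega> n + fst (\<omega> n)) \<in> walk_space \<rightarrow>\<^sub>M count_space UNIV"
    by (rule measurable_compose_countable[OF measurable_compose[OF step] Suc[of u]]) simp
  moreover have "walk_pos u \<omega> (Suc n) = walk_pos u \<omega> n + fst (\<omega> n)" for \<omega>
    by (simp add: walk_pos_def plus_prod_def algebra_simps)
  ultimately show ?case by simp
qed simp

lemma measurable_visit_time [measurable]: "visit_time D u v n \<in> borel_measurable walk_space"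
proof -
  have [measurable]: "(\<lambda>\<omega>. snd (\<omega> n)) \<in> borel_measurable walk_space"
  proof -
    have "snd \<in> jump_law \<rightarrow>\<^sub>M density lborel (\<lambda>t. ennreal (exponential_density 4 t))"
      unfolding jump_law_def by (rule measurable_snd)
    then have "snd \<in> jump_law \<rightarrow>\<^sub>M borel"
      by (simp cong: measurable_cong_sets)
    then show ?thesis
      unfolding walk_space_eq by measurable
  qed
  show ?thesis
    unfolding visit_time_def[abs_def] by measurable
qed

lemma nn_integral_first_step:
  assumes [measurable]: "f \<in> borel_measurable walk_space"
  shows "(\<integral>\<^sup>+ \<omega>. f \<omega> \<partial>walk_space) = (\<integral>\<^sup>+ s. (\<integral>\<^sup>+ \<omega>. f (case_nat s \<omega>) \<partial>walk_space) \<partial>jump_law)"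
proof -
  interpret sequence_space jump_law by (rule sequence_space_jump_law)
  interpret W: prob_space "walk_space" unfolding walk_space_eq by unfold_locales
  have [measurable]: "f \<in> borel_measurable S" using assms by (simp add: walk_space_eq)
  have "(\<integral>\<^sup>+ \<omega>. f \<omega> \<partial>walk_space) = (\<integral>\<^sup>+ \<omega>. f \<omega> \<partial>distr (jump_law \<Otimes>\<^sub>M S) S (\<lambda>(s, \<omega>). case_nat s \<omega>))"
    unfolding PiM_iter by (simp add: walk_space_eq)
  also have "\<dots> = (\<integral>\<^sup>+ p. f (case_nat (fst p) (snd p)) \<partial>(jump_law \<Otimes>\<^sub>M S))"
    by (subst nn_integral_distr) (auto simp: case_prod_beta)
  also have "\<dots> = (\<integral>\<^sup>+ s. (\<integral>\<^sup>+ \<omega>. f (case_nat s \<omega>) \<partial>S) \<partial>jump_law)"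
    using W.nn_integral_fst[of "\<lambda>p. f (case_nat (fst p) (snd p))" jump_law] unfolding walk_space_eq by simp
  finally show ?thesis by (simp add: walk_space_eq)
qed

text \<open>
  The probability that the walk from \<open>u\<close> is at \<open>v\<close> after \<open>n\<close> jumps and has avoided \<open>D\<close> up
  to then, through its first-step recurrence.
\<close>

fun visit_prob :: "(int \<times> int) set \<Rightarrow> nat \<Rightarrow> int \<times> int \<Rightarrow> int \<times> int \<Rightarrow> real" where
  "visit_prob D 0 u v = (if u = v \<and> u \<notin> D then 1 else 0)"
| "visit_prob D (Suc n) u v = (if u \<in> D then 0 else (\<Sum>e\<in>unit_steps. visit_prob D n (u + e) v) / 4)"

lemma visit_prob_nonneg: "0 \<le> visit_prob D n u v"
  by (induction D n u v rule: visit_prob.induct) (auto intro!: divide_nonneg_nonneg sum_nonneg)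

text \<open>
  The factor \<open>1 / 4\<close> is the mean holding time. It is split off at the end of the recursion,
  when the path has been shifted until the holding time in question is the first one.
\<close>

lemma nn_integral_visit_time:
  "(\<integral>\<^sup>+ \<omega>. visit_time D u v n \<omega> \<partial>walk_space) = ennreal (visit_prob D n u v / 4)"
proof (induction n arbitrary: u)
  interpret sequence_space jump_law by (rule sequence_space_jump_law)
  interpret W: prob_space "walk_space" unfolding walk_space_eq by unfold_locales
  {
    case 0
    have "(\<integral>\<^sup>+ \<omega>. visit_time D u v 0 \<omega> \<partial>walk_space)
        = (\<integral>\<^sup>+ s. (if u = v \<and> u \<notin> D then ennreal (snd s) else 0) \<partial>jump_law)"
    proof -
      have "(\<integral>\<^sup>+ \<omega>. visit_time D u v 0 (case_nat s \<omega>) \<partial>walk_space)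
          = (if u = v \<and> u \<notin> D then ennreal (snd s) else 0)" for s
      proof -
        have "visit_time D u v 0 (case_nat s \<omega>) = (if u = v \<and> u \<notin> D then ennreal (snd s) else 0)" for \<omega>
          by (auto simp: visit_time_def)
        then show ?thesis by (simp add: W.emeasure_space_1)
      qed
      then show ?thesis by (subst nn_integral_first_step) simp_all
    qed
    then show ?case
      by (cases "u = v"; cases "u \<in> D") (simp_all add: nn_integral_jump_law_time)
  next
    case (Suc n)
    have "(\<integral>\<^sup>+ \<omega>. visit_time D u v (Suc n) \<omega> \<partial>walk_space)
        = (\<integral>\<^sup>+ s. (if u \<in> D then 0 else ennreal (visit_prob D n (u + fst s) v / 4)) \<partial>jump_law)"
      by (subst nn_integral_first_step) (auto simp: visit_time_case_nat Suc intro!: nn_integral_cong)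
    also have "\<dots> = (if u \<in> D then 0 else (\<Sum>e\<in>unit_steps. ennreal (visit_prob D n (u + e) v / 4)) / 4)"
      by (simp add: nn_integral_jump_law_step[where g = "\<lambda>e. ennreal (visit_prob D n (u + e) v / 4)"])
    also have "(\<Sum>e\<in>unit_steps. ennreal (visit_prob D n (u + e) v / 4))
        = ennreal (\<Sum>e\<in>unit_steps. visit_prob D n (u + e) v / 4)"
      by (rule sum_ennreal) (simp add: visit_prob_nonneg)
    finally show ?case
      by (simp add: divide_ennreal sum_nonneg visit_prob_nonneg ennreal_numeral[symmetric] sum_divide_distrib[symmetric] del: ennreal_numeral)
  }
qed

lemma greens_function_sums:
  assumes "(\<lambda>n. visit_prob D n u v / 4) sums g"
  shows "greens_function D u v = g"
proof -
  have "(\<integral>\<^sup>+ \<omega>. time_spent D u v \<omega> \<partial>walk_space) = (\<integral>\<^sup>+ \<omega>. (\<Sum>n. visit_time D u v n \<omega>) \<partial>walk_space)"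
    by (simp add: time_spent_def visit_time_def)
  also have "\<dots> = (\<Sum>n. ennreal (visit_prob D n u v / 4))"
    by (simp add: nn_integral_suminf nn_integral_visit_time)
  also have "\<dots> = ennreal g"
    using assms by (intro suminf_ennreal_eq) (auto simp: visit_prob_nonneg)
  finally show ?thesis
    using sums_le[OF _ sums_zero assms] by (simp add: greens_function_def visit_prob_nonneg)
qed

lemma visit_prob_outside: "u \<in> D \<or> v \<in> D \<Longrightarrow> visit_prob D n u v = 0"
  by (induction n arbitrary: u) (auto simp: unit_steps_def)

text \<open>
  First-step analysis moves the starting point, while harmonicity concerns the end point.
  Both recurrences hold because steps on the two ends commute; this expresses the symmetry
  of the killed walk.
\<close>

lemma visit_prob_last_step:
  "visit_prob D (Suc n) u v = (if v \<in> D then 0 else (\<Sum>e\<in>unit_steps. visit_prob D n u (v + e)) / 4)"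
proof (induction n arbitrary: u)
  case 0
  show ?case
    by (cases u; cases v) (auto simp: unit_steps_def)
next
  case (Suc n)
  show ?case
  proof (cases "u \<in> D \<or> v \<in> D")
    case True
    then show ?thesis by (auto simp: visit_prob_outside simp del: visit_prob.simps)
  next
    case False
    then have "visit_prob D (Suc (Suc n)) u v
        = (\<Sum>e\<in>unit_steps. (\<Sum>e'\<in>unit_steps. visit_prob D n (u + e) (v + e')) / 4) / 4"
      unfolding visit_prob.simps(2)[of _ "Suc n"] Suc.IH by simp
    also have "\<dots> = (\<Sum>e'\<in>unit_steps. (\<Sum>e\<in>unit_steps. visit_prob D n (u + e) (v + e')) / 4) / 4"
      unfolding sum_divide_distrib by (subst sum.swap) simp
    also have "\<dots> = (\<Sum>e'\<in>unit_steps. visit_prob D (Suc n) u (v + e')) / 4"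
      using False by simp
    finally show ?thesis using False by simp
  qed
qed

section \<open>The Poisson equation determines the Green's function\<close>

text \<open>
  The expectation of \<open>\<psi>\<close> at time \<open>n\<close> of a simple random walk on the integers that starts at
  \<open>y\<close>.
\<close>

definition srw_average :: "(int \<Rightarrow> real) \<Rightarrow> nat \<Rightarrow> int \<Rightarrow> real" where
  "srw_average \<psi> n y = (\<Sum>k\<le>n. real (n choose k) * \<psi> (y + 2 * int k - int n)) / 2 ^ n"

lemma srw_average_Suc:
  "srw_average \<psi> (Suc n) y = (srw_average \<psi> n (y + 1) + srw_average \<psi> n (y - 1)) / 2"
proof -
  define g where "g k = \<psi> (y + 2 * int k - int (Suc n))" for k
  have "(\<Sum>k\<le>Suc n. real (Suc n choose k) * g k)
      = (\<Sum>k\<le>n. real (n choose k) * g (Suc k)) + (\<Sum>k\<le>n. real (n choose k) * g k)"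
  proof -
    have "(\<Sum>k\<le>Suc n. real (Suc n choose k) * g k)
        = g 0 + (\<Sum>k\<le>n. real (n choose k) * g (Suc k) + real (n choose Suc k) * g (Suc k))"
      by (subst sum.atMost_Suc_shift) (simp add: algebra_simps)
    also have "\<dots> = (\<Sum>k\<le>n. real (n choose k) * g (Suc k)) + (g 0 + (\<Sum>k\<le>n. real (n choose Suc k) * g (Suc k)))"
      by (simp add: sum.distrib)
    also have "g 0 + (\<Sum>k\<le>n. real (n choose Suc k) * g (Suc k)) = (\<Sum>k\<le>Suc n. real (n choose k) * g k)"
      by (subst sum.atMost_Suc_shift) simp
    finally show ?thesis by (simp add: binomial_eq_0)
  qed
  then show ?thesis
    by (simp add: srw_average_def g_def add_divide_distrib algebra_simps)
qed

lemma central_binomial_le: "real (n choose k) / 2 ^ n \<le> cbin (n div 2)"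
proof -
  have "real (n choose k) \<le> real (n choose (n div 2))"
    by (simp add: binomial_maximum)
  also have "real (n choose (n div 2)) \<le> 2 ^ n * cbin (n div 2)"
  proof (cases "even n")
    case True
    then obtain m where "n = 2 * m" by (elim evenE)
    then show ?thesis by (simp add: cbin_def power_mult)
  next
    case False
    then obtain m where n: "n = 2 * m + 1" by (elim oddE)
    have "(n choose m) \<le> 2 * ((2 * m) choose m)"
    proof (cases m)
      case (Suc m')
      have "n choose m = ((2 * m) choose m') + ((2 * m) choose m)"
        using n Suc by simp
      also have "(2 * m) choose m' \<le> (2 * m) choose m"
        using binomial_maximum[of "2 * m" m'] by simp
      finally show ?thesis by simp
    qed (simp add: n)
    then have "real (n choose m) \<le> 2 * real ((2 * m) choose m)"
      by (metis of_nat_le_iff of_nat_mult of_nat_numeral)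
    then show ?thesis by (simp add: n cbin_def power_mult)
  qed
  finally show ?thesis by (simp add: divide_le_eq mult.commute)
qed

text \<open>
  The walk leaves every bounded set: each point has probability at most \<open>cbin (n div 2)\<close>,
  and \<open>{- M..M}\<close> has \<open>2 * M + 1\<close> points. Outside of that set \<open>\<psi>\<close> is small.
\<close>

lemma srw_average_tendsto_0:
  assumes bound: "\<And>y. \<bar>\<psi> y\<bar> \<le> C" and decay: "\<And>e. 0 < e \<Longrightarrow> \<exists>M. \<forall>y. int M < \<bar>y\<bar> \<longrightarrow> \<bar>\<psi> y\<bar> \<le> e"
  shows "(\<lambda>n. srw_average \<psi> n y) \<longlonglongrightarrow> 0"
proof (rule LIMSEQ_I)
  fix e :: real assume e: "0 < e"
  have C: "0 \<le> C" using bound[of 0] by linarith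
  obtain M where M: "\<And>y. int M < \<bar>y\<bar> \<Longrightarrow> \<bar>\<psi> y\<bar> \<le> e / 2"
    using decay[of "e / 2"] e by auto
  have est: "\<bar>srw_average \<psi> n y\<bar> \<le> e / 2 + C * real (2 * M + 1) * cbin (n div 2)" for n
  proof -
    \<comment> \<open>The outcomes that end within distance \<open>M\<close> of the origin.\<close>
    define K where "K = {k. k \<le> n \<and> \<bar>y + 2 * int k - int n\<bar> \<le> int M}"
    have K: "finite K" "K \<subseteq> {..n}" by (auto simp: K_def intro: finite_subset[of _ "{..n}"])
    have "card K \<le> card {- int M..int M}"
      by (rule card_inj_on_le[where f = "\<lambda>k. y + 2 * int k - int n"]) (auto simp: K_def inj_on_def)
    then have cK: "card K \<le> 2 * M + 1" by simp
    have "\<bar>srw_average \<psi> n y\<bar> \<le> (\<Sum>k\<le>n. real (n choose k) / 2 ^ n * \<bar>\<psi> (y + 2 * int k - int n)\<bar>)"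
      unfolding srw_average_def sum_divide_distrib
      by (rule order_trans[OF sum_abs]) (simp add: abs_mult)
    also have "\<dots> \<le> (\<Sum>k\<le>n. real (n choose k) / 2 ^ n * (e / 2) + (if k \<in> K then cbin (n div 2) * C else 0))"
    proof (rule sum_mono)
      fix k assume k: "k \<in> {..n}"
      let ?p = "real (n choose k) / 2 ^ n" and ?a = "\<bar>\<psi> (y + 2 * int k - int n)\<bar>"
      have p: "0 \<le> ?p" by simp
      show "?p * ?a \<le> ?p * (e / 2) + (if k \<in> K then cbin (n div 2) * C else 0)"
      proof (cases "k \<in> K")
        case True
        have "?p * ?a \<le> cbin (n div 2) * C"
          by (intro mult_mono central_binomial_le bound cbin_nonneg) simp
        moreover have "0 \<le> ?p * (e / 2)" using p e by simp
        ultimately show ?thesis using True by simp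
      next
        case False
        then have "?a \<le> e / 2" using k by (intro M) (auto simp: K_def)
        from mult_left_mono[OF this p] show ?thesis using False by simp
      qed
    qed
    also have "\<dots> = e / 2 * ((\<Sum>k\<le>n. real (n choose k)) / 2 ^ n) + real (card K) * (cbin (n div 2) * C)"
    proof -
      have "(\<Sum>k\<le>n. (if k \<in> K then cbin (n div 2) * C else 0)) = real (card K) * (cbin (n div 2) * C)"
        using K by (simp add: sum.If_cases Int_absorb1)
      moreover have "(\<Sum>k\<le>n. real (n choose k) / 2 ^ n * (e / 2)) = e / 2 * ((\<Sum>k\<le>n. real (n choose k)) / 2 ^ n)"
        by (simp add: sum_distrib_left sum_divide_distrib mult_ac)
      ultimately show ?thesis by (simp add: sum.distrib)
    qed
    also have "(\<Sum>k\<le>n. real (n choose k)) / 2 ^ n = 1"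
    proof -
      have "(\<Sum>k\<le>n. real (n choose k)) = real (2 ^ n)"
        by (simp only: choose_row_sum[symmetric] of_nat_sum)
      then show ?thesis by simp
    qed
    also have "real (card K) * (cbin (n div 2) * C) \<le> real (2 * M + 1) * (cbin (n div 2) * C)"
      using cK C cbin_nonneg by (intro mult_right_mono) (auto simp del: of_nat_add of_nat_mult)
    finally show ?thesis by (simp add: mult_ac)
  qed
  have "filterlim (\<lambda>n::nat. n div 2) at_top sequentially"
    unfolding filterlim_at_top eventually_sequentially
  proof
    fix Z :: nat
    show "\<exists>N. \<forall>n\<ge>N. Z \<le> n div 2" by (rule exI[of _ "2 * Z"]) auto
  qed
  then have "(\<lambda>n. C * real (2 * M + 1) * cbin (n div 2)) \<longlonglongrightarrow> 0"
    by (intro tendsto_mult_right_zero filterlim_compose[OF cbin_tendsto_0])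
  then have "\<forall>\<^sub>F n in sequentially. C * real (2 * M + 1) * cbin (n div 2) < e / 2"
    using e by (intro order_tendstoD) auto
  then obtain N where N: "\<And>n. N \<le> n \<Longrightarrow> C * real (2 * M + 1) * cbin (n div 2) < e / 2"
    unfolding eventually_sequentially by blast
  show "\<exists>N. \<forall>n\<ge>N. norm (srw_average \<psi> n y - 0) < e"
  proof (intro exI allI impI)
    fix n assume "N \<le> n"
    from N[OF this] est[of n] show "norm (srw_average \<psi> n y - 0) < e" by simp
  qed
qed

text \<open>One step of the transition semigroup of the walk killed on \<open>D\<close>.\<close>

definition killed_step :: "(int \<times> int) set \<Rightarrow> (int \<times> int \<Rightarrow> real) \<Rightarrow> int \<times> int \<Rightarrow> real" where
  "killed_step D f v = (if v \<in> D then 0 else (\<Sum>e\<in>unit_steps. f (v + e)) / 4)"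

lemma sum_unit_steps: "(\<Sum>e\<in>unit_steps. f e) = f (1, 0) + f (-1, 0) + f (0, 1) + f (0, -1)"
  for f :: "int \<times> int \<Rightarrow> 'a::comm_monoid_add"
  by (simp add: unit_steps_def add.assoc)

text \<open>
  The difference of the two coordinates changes by \<open>1\<close> or \<open>- 1\<close> with equal probability in
  each step, and killing only decreases absolute values.
\<close>

lemma killed_step_funpow_bound:
  assumes "\<And>v. \<bar>f v\<bar> \<le> \<psi> (snd v - fst v)"
  shows "\<bar>(killed_step D ^^ n) f v\<bar> \<le> srw_average \<psi> n (snd v - fst v)"
proof (induction n arbitrary: v)
  case 0
  show ?case using assms[of v] by (simp add: srw_average_def)
next
  case (Suc n)
  let ?g = "(killed_step D ^^ n) f" and ?A = "srw_average \<psi> n"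
  have "\<bar>killed_step D ?g v\<bar> \<le> (\<Sum>e\<in>unit_steps. \<bar>?g (v + e)\<bar>) / 4"
    by (auto simp: killed_step_def sum_nonneg intro: sum_abs)
  also have "\<dots> \<le> (\<Sum>e\<in>unit_steps. ?A (snd (v + e) - fst (v + e))) / 4"
    by (intro divide_right_mono sum_mono Suc.IH) simp
  also have "\<dots> = srw_average \<psi> (Suc n) (snd v - fst v)"
    by (simp add: sum_unit_steps srw_average_Suc algebra_simps)
  finally show ?case by simp
qed

text \<open>
  Iterating the Poisson equation \<open>n\<close> times expresses \<open>f\<close> by the first \<open>n\<close> terms of the
  Green's function and the remainder \<open>(killed_step D ^^ n) f\<close>. The latter tends to zero,
  because the difference of the coordinates is a simple random walk and \<open>f\<close> is small where
  that difference is large. In particular the sum is finite.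
\<close>

lemma greens_function_unique:
  assumes eq: "\<And>v. f v = (if v = u \<and> u \<notin> D then 1 / 4 else 0) + killed_step D f v"
    and bd: "\<And>v. \<bar>f v\<bar> \<le> \<psi> (snd v - fst v)"
    and \<psi>: "\<And>y. \<bar>\<psi> y\<bar> \<le> C" "\<And>e. 0 < e \<Longrightarrow> \<exists>M. \<forall>y. int M < \<bar>y\<bar> \<longrightarrow> \<bar>\<psi> y\<bar> \<le> e"
  shows "greens_function D u v = f v"
proof (rule greens_function_sums)
  have lin: "killed_step D (\<lambda>v. g v + h v) = (\<lambda>v. killed_step D g v + killed_step D h v)" for g h
    by (auto simp: killed_step_def fun_eq_iff sum.distrib add_divide_distrib)
  have pr: "killed_step D (\<lambda>v. visit_prob D n u v / 4) = (\<lambda>v. visit_prob D (Suc n) u v / 4)" for n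
    unfolding visit_prob_last_step by (auto simp: killed_step_def fun_eq_iff simp flip: sum_divide_distrib)
  have zero: "killed_step D (\<lambda>v. 0) = (\<lambda>v. 0)"
    by (auto simp: killed_step_def fun_eq_iff)
  have part: "f v = (\<Sum>i<n. visit_prob D i u v / 4) + (killed_step D ^^ n) f v" for n v
  proof -
    have it: "(killed_step D ^^ n) f v = visit_prob D n u v / 4 + (killed_step D ^^ Suc n) f v" for n v
    proof (induction n arbitrary: v)
      case 0
      show ?case using eq[of v] by simp
    next
      case (Suc n)
      have "(killed_step D ^^ n) f = (\<lambda>v. visit_prob D n u v / 4 + (killed_step D ^^ Suc n) f v)"
        using Suc.IH by blast
      then have "killed_step D ((killed_step D ^^ n) f) v
          = killed_step D (\<lambda>v. visit_prob D n u v / 4 + (killed_step D ^^ Suc n) f v) v"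
        by simp
      then show ?case unfolding lin pr by simp
    qed
    show ?thesis
    proof (induction n)
      case (Suc n)
      then show ?case using it[of n v] by simp
    qed simp
  qed
  have "(\<lambda>n. (killed_step D ^^ n) f v) \<longlonglongrightarrow> 0"
  proof (rule tendsto_rabs_zero_cancel, rule tendsto_sandwich[OF _ _ tendsto_const])
    show "(\<lambda>n. srw_average \<psi> n (snd v - fst v)) \<longlonglongrightarrow> 0"
      by (rule srw_average_tendsto_0[OF \<psi>])
    have "\<bar>(killed_step D ^^ n) f v\<bar> \<le> srw_average \<psi> n (snd v - fst v)" for n
      by (rule killed_step_funpow_bound) (rule bd)
    then show "\<forall>\<^sub>F n in sequentially. \<bar>(killed_step D ^^ n) f v\<bar> \<le> srw_average \<psi> n (snd v - fst v)"
      by simp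
  qed simp
  then have "(\<lambda>n. f v - (killed_step D ^^ n) f v) \<longlonglongrightarrow> f v - 0"
    by (intro tendsto_diff tendsto_const)
  moreover have "(\<Sum>i<n. visit_prob D i u v / 4) = f v - (killed_step D ^^ n) f v" for n
    using part[of v n] by simp
  ultimately show "(\<lambda>n. visit_prob D n u v / 4) sums f v"
    by (simp add: sums_def)
qed

section \<open>The Green's function of the slit plane\<close>

text \<open>The boundary values on the axis, meant for even \<open>x\<close>.\<close>

definition axis_value :: "int \<Rightarrow> real" where
  "axis_value x = (if 0 \<le> x then cbin (nat (x div 2)) else 0)"

lemma slit_green_axis_value:
  assumes "even x"
  shows "slit_green x 0 = axis_value x"
proof (cases "0 \<le> x")
  case True
  then have "x = 2 * int (nat (x div 2))" using assms by simp
  then show ?thesis using True slit_green_axis(1)[of "nat (x div 2)"] by (simp add: axis_value_def)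
next
  case False
  obtain m where "x = 2 * m" using assms by (elim evenE)
  then have "x = - 2 * int (Suc (nat (- m - 1)))" using False by simp
  then show ?thesis using False slit_green_axis(2) by (metis axis_value_def)
qed

text \<open>
  The coefficients of \<open>sqrt (1 - w)\<close> are differences of those of \<open>(1 - w) powr (- 1 / 2)\<close>.
  In this form one equation covers the slit, the origin and the positive axis.
\<close>

lemma slit_charge_axis_value:
  assumes "even x"
  shows "slit_charge x = axis_value (- x) - axis_value (- x - 2)"
proof (cases x "0 :: int" rule: linorder_cases)
  case greater
  obtain m where "x = 2 * m" using assms by (elim evenE)
  then have x: "x = 2 * int (Suc (nat (m - 1)))" using greater by simp
  have "slit_charge x = 0" by (subst x) (rule slit_charge_axis(1))
  then show ?thesis using greater by (simp add: axis_value_def)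
next
  case equal
  then show ?thesis by (simp add: slit_charge_origin axis_value_def)
next
  case less
  obtain m where m: "x = 2 * m" using assms by (elim evenE)
  define k where "k = nat (- m - 1)"
  have x: "x = - 2 * int (Suc k)" using m less by (simp add: k_def)
  have "nat ((- x) div 2) = Suc k" "nat ((- x - 2) div 2) = k" using x by auto
  then show ?thesis
    using less slit_charge_axis(2)[of k] x by (simp add: axis_value_def)
qed

text \<open>
  Reflected in the diagonal and halved, \<open>slit_green\<close> solves the Poisson equation on the
  slit plane with source \<open>1 / 4\<close> at the origin.
\<close>

lemma G_H_eq_slit_green:
  assumes "in_domain x y"
  shows "G_H x y = slit_green x y"
proof -
  define f where "f v = slit_green (fst v + snd v) \<bar>snd v - fst v\<bar> / 2" for v
  define \<psi> where "\<psi> y = sqrt 2 * cbin (nat \<bar>y\<bar> div 2) / 2" for y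
  have "greens_function neg_diagonal (0, 0) v = f v" for v
  proof (rule greens_function_unique)
    show "\<bar>f v\<bar> \<le> \<psi> (snd v - fst v)" for v
      using abs_slit_green_le[of "fst v + snd v" "\<bar>snd v - fst v\<bar>"] by (simp add: f_def \<psi>_def)
    show "\<bar>\<psi> y\<bar> \<le> sqrt 2 / 2" for y
      using cbin_nonneg cbin_le_1 by (auto simp: \<psi>_def abs_mult)
    show "\<exists>M. \<forall>y. int M < \<bar>y\<bar> \<longrightarrow> \<bar>\<psi> y\<bar> \<le> e" if "0 < e" for e
    proof -
      have "(\<lambda>k. sqrt 2 * cbin k / 2) \<longlonglongrightarrow> 0"
        using tendsto_mult[OF tendsto_const[of "sqrt 2 / 2"] cbin_tendsto_0] by simp
      then have "\<forall>\<^sub>F k in sequentially. sqrt 2 * cbin k / 2 < e"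
        using that by (intro order_tendstoD) auto
      then obtain N where N: "\<And>k. N \<le> k \<Longrightarrow> sqrt 2 * cbin k / 2 < e"
        unfolding eventually_sequentially by blast
      have "\<bar>\<psi> y\<bar> \<le> e" if "int (2 * N) < \<bar>y\<bar>" for y
      proof -
        have "N \<le> nat \<bar>y\<bar> div 2" using that by linarith
        from N[OF this] show ?thesis using cbin_nonneg by (simp add: \<psi>_def)
      qed
      then show ?thesis by blast
    qed
    show "f v = (if v = (0, 0) \<and> (0, 0) \<notin> neg_diagonal then 1 / 4 else 0) + killed_step neg_diagonal f v" for v
    proof -
      obtain a b where v: "v = (a, b)" by (cases v)
      define x y where "x = a + b" and "y = \<bar>b - a\<bar>"
      have par: "even (x + y)" by (auto simp: x_def y_def)
      have 0: "(0, 0) \<notin> neg_diagonal" by (auto simp: neg_diagonal_def)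
      have nb: "(\<Sum>e\<in>unit_steps. f (v + e)) = (slit_green (x + 1) \<bar>b - a - 1\<bar> + slit_green (x - 1) \<bar>b - a + 1\<bar>
          + slit_green (x + 1) \<bar>b - a + 1\<bar> + slit_green (x - 1) \<bar>b - a - 1\<bar>) / 2"
        by (simp add: sum_unit_steps v f_def x_def algebra_simps)
      have "1 \<le> y \<or> y = 0 \<and> a \<le> -1 \<or> y = 0 \<and> 0 \<le> a"
        unfolding y_def by arith
      then consider "1 \<le> y" | "y = 0" "a \<le> -1" | "y = 0" "0 \<le> a" by blast
      then show ?thesis
      proof cases
        case 1
        have "(\<Sum>e\<in>unit_steps. f (v + e)) = (slit_green (x + 1) (y + 1) + slit_green (x + 1) (y - 1)
            + slit_green (x - 1) (y + 1) + slit_green (x - 1) (y - 1)) / 2"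
        proof (cases "a < b")
          case True
          then have "\<bar>b - a - 1\<bar> = y - 1" "\<bar>b - a + 1\<bar> = y + 1" using 1 by (auto simp: y_def)
          then show ?thesis unfolding nb by simp
        next
          case False
          then have "\<bar>b - a - 1\<bar> = y + 1" "\<bar>b - a + 1\<bar> = y - 1" using 1 by (auto simp: y_def)
          then show ?thesis unfolding nb by simp
        qed
        also have "\<dots> = 4 * f v"
        proof -
          have "f v = slit_green x y / 2" by (simp add: f_def v x_def y_def)
          then show ?thesis using slit_green_harmonic[OF 1, of x] by simp
        qed
        finally show ?thesis
          using 1 by (auto simp: killed_step_def v neg_diagonal_def y_def)
      next
        case 2
        then have "f v = axis_value x / 2"
          using par by (simp add: f_def v y_def x_def slit_green_axis_value)
        moreover have "v \<in> neg_diagonal" using 2 by (auto simp: v neg_diagonal_def y_def)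
        ultimately show ?thesis
          using 2 0 by (auto simp: killed_step_def axis_value_def x_def y_def)
      next
        case 3
        have ab: "b = a" using 3 by (simp add: y_def)
        have "f v = (slit_green (x - 1) 1 + slit_green (x + 1) 1 + slit_charge x) / 4"
          by (simp add: slit_charge_def f_def v x_def ab)
        also have "slit_charge x = (if v = (0, 0) then 1 else 0)"
          using 3 par by (auto simp: slit_charge_axis_value axis_value_def v x_def ab)
        finally have "f v = (slit_green (x - 1) 1 + slit_green (x + 1) 1 + (if v = (0, 0) then 1 else 0)) / 4" .
        moreover have "v \<notin> neg_diagonal" using 3 by (auto simp: v neg_diagonal_def)
        ultimately show ?thesis
          using 0 by (simp add: killed_step_def nb ab add_divide_distrib)
      qed
    qed
  qed
  then have "G_H x y = 2 * f ((x - y) div 2, (x + y) div 2)"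
    by (simp add: G_H_def)
  moreover have "(x - y) div 2 + (x + y) div 2 = x" "\<bar>(x + y) div 2 - (x - y) div 2\<bar> = y"
    using assms unfolding in_domain_def by presburger+
  ultimately show ?thesis by (simp add: f_def)
qed

section \<open>Uniqueness of solutions of the relations\<close>

text \<open>
  Once the coefficients below \<open>k\<close> agree, the \<open>k\<close>-th ones are limits at \<open>0\<close> of the same
  quotient.
\<close>

lemma even_power_series_unique:
  fixes a b :: "nat \<Rightarrow> real"
  assumes a: "\<And>z. \<bar>z\<bar> < 1 \<Longrightarrow> (\<lambda>k. a k * z ^ (2 * k)) sums f z"
    and b: "\<And>z. \<bar>z\<bar> < 1 \<Longrightarrow> (\<lambda>k. b k * z ^ (2 * k)) sums f z"
  shows "a k = b k"
proof (induction k rule: less_induct)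
  case (less k)
  \<comment> \<open>The difference series divided by \<open>z ^ (2 * k)\<close>, padded with zeros in odd degree.\<close>
  define c where "c m = (if even m then a (m div 2 + k) - b (m div 2 + k) else 0)" for m
  have c_sums: "(\<lambda>m. c m * z ^ m) sums 0" if z: "z \<noteq> 0" "norm z < 1" for z
  proof -
    have "(\<lambda>n. (a n - b n) * z ^ (2 * n)) sums 0"
      using sums_diff[OF a b, of z z] z by (simp add: left_diff_distrib)
    moreover have "(\<Sum>n<k. (a n - b n) * z ^ (2 * n)) = 0"
      using less by (intro sum.neutral) auto
    ultimately have "(\<lambda>n. (a (n + k) - b (n + k)) * z ^ (2 * (n + k))) sums 0"
      by (subst sums_iff_shift) simp
    then have "(\<lambda>n. (a (n + k) - b (n + k)) * z ^ (2 * (n + k)) / z ^ (2 * k)) sums (0 / z ^ (2 * k))"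
      by (rule sums_divide)
    then have "(\<lambda>n. c (2 * n) * z ^ (2 * n)) sums 0"
      using z by (simp add: c_def distrib_left power_add)
    then show ?thesis
      by (subst (asm) sums_mono_reindex[where f = "\<lambda>m. c m * z ^ m" and g = "\<lambda>n. 2 * n"])
         (auto simp: strict_mono_def c_def elim!: evenE)
  qed
  have "((\<lambda>_. 0) \<longlongrightarrow> c 0) (at (0::real))"
    by (rule powser_limit_0_strong[of 1]) (auto intro: c_sums)
  from tendsto_unique[OF _ this tendsto_const] have "c 0 = 0"
    by simp
  then show ?case by (simp add: c_def)
qed

text \<open>
  The lowest point of a column has height \<open>0\<close> or \<open>1\<close>, according to the parity of the
  column.
\<close>

lemma alternating_column_eq_0:
  assumes "\<And>y. in_domain x y \<Longrightarrow> E x (y + 2) = - E x y"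
    and "even x \<Longrightarrow> E x 0 = 0" "odd x \<Longrightarrow> E x 1 = (0::real)"
    and "in_domain x y"
  shows "E x y = 0"
  using assms(4)
proof (induction "nat y" arbitrary: y rule: less_induct)
  case less
  show ?case
  proof (cases "2 \<le> y")
    case True
    then have "in_domain x (y - 2)" using less.prems by (simp add: in_domain_def)
    with less.hyps[of "y - 2"] True assms(1)[of "y - 2"] show ?thesis by simp
  next
    case False
    then have "y = 0 \<or> y = 1"
      using less.prems unfolding in_domain_def by linarith
    then show ?thesis using assms(2,3) less.prems by (auto simp: in_domain_def)
  qed
qed

definition vanishing_column :: "(int \<Rightarrow> int \<Rightarrow> real) \<Rightarrow> int \<Rightarrow> bool" where
  "vanishing_column E x \<longleftrightarrow> (\<forall>y. in_domain x y \<longrightarrow> E x y = 0)"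

text \<open>
  The relations satisfied by the difference of two solutions; the generating function on
  the positive axis enters as the vanishing of \<open>E\<close> there.
\<close>

locale homogeneous_relations =
  fixes E :: "int \<Rightarrow> int \<Rightarrow> real"
  assumes harmonic: "\<And>x y. even (x + y) \<Longrightarrow> 1 \<le> y \<Longrightarrow>
      4 * E x y = E (x + 1) (y + 1) + E (x + 1) (y - 1) + E (x - 1) (y + 1) + E (x - 1) (y - 1)"
    and axis: "\<And>x. even x \<Longrightarrow> E x 0 = 0"
    and axis_neighbours: "\<And>x. even x \<Longrightarrow> 0 \<le> x \<Longrightarrow> E (x - 1) 1 + E (x + 1) 1 = 0"
    and vertical: "\<And>k. 0 \<le> k \<Longrightarrow> E 0 (2 * k) + E 0 (2 * k + 2) = 0"
    and adjacent: "\<And>y. 0 < y \<Longrightarrow> even y \<Longrightarrow> E 0 y = E (- 1) (y - 1)"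
begin

lemma alternating_right:
  assumes "vanishing_column E x" "vanishing_column E (x - 1)" "in_domain (x + 1) y"
  shows "E (x + 1) (y + 2) = - E (x + 1) y"
proof -
  have y: "y + 1 + 1 = y + 2" "y + 1 - 1 = y" by simp_all
  have par: "even (x + (y + 1))" "1 \<le> y + 1"
    using assms(3) by (auto simp: in_domain_def)
  have "E x (y + 1) = 0" "E (x - 1) (y + 2) = 0" "E (x - 1) y = 0"
    using assms by (auto simp: vanishing_column_def in_domain_def)
  then show ?thesis
    using harmonic[of x "y + 1", OF par] unfolding y by simp
qed

lemma alternating_left:
  assumes "vanishing_column E x" "vanishing_column E (x + 1)" "in_domain (x - 1) y"
  shows "E (x - 1) (y + 2) = - E (x - 1) y"
proof -
  have y: "y + 1 + 1 = y + 2" "y + 1 - 1 = y" by simp_all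
  have par: "even (x + (y + 1))" "1 \<le> y + 1"
    using assms(3) by (auto simp: in_domain_def)
  have "E x (y + 1) = 0" "E (x + 1) (y + 2) = 0" "E (x + 1) y = 0"
    using assms by (auto simp: vanishing_column_def in_domain_def)
  then show ?thesis
    using harmonic[of x "y + 1", OF par] unfolding y by simp
qed

lemma vanishing_column_0: "vanishing_column E 0"
  unfolding vanishing_column_def
proof (intro allI impI)
  fix y assume "in_domain 0 y"
  then show "E 0 y = 0"
  proof (rule alternating_column_eq_0[rotated 3])
    fix y assume "in_domain 0 y"
    then show "E 0 (y + 2) = - E 0 y"
      using vertical[of "y div 2"] by (simp add: in_domain_def)
  qed (auto simp: axis)
qed

lemma vanishing_column_minus_1: "vanishing_column E (- 1)"
  unfolding vanishing_column_def
proof (intro allI impI)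
  fix y assume "in_domain (- 1) y"
  then show "E (- 1) y = 0"
    using adjacent[of "y + 1"] vanishing_column_0 by (simp add: vanishing_column_def in_domain_def)
qed

lemma vanishing_column_nonneg: "vanishing_column E (int n) \<and> vanishing_column E (int n - 1)"
proof (induction n)
  case 0
  show ?case using vanishing_column_0 vanishing_column_minus_1 by simp
next
  case (Suc n)
  have "E (int n + 1) y = 0" if "in_domain (int n + 1) y" for y
    using _ _ _ that
  proof (rule alternating_column_eq_0)
    show "E (int n + 1) 1 = 0" if "odd (int n + 1)"
      using axis_neighbours[of "int n"] Suc that by (auto simp: vanishing_column_def in_domain_def)
  qed (use Suc in \<open>auto intro: alternating_right axis\<close>)
  then show ?case using Suc by (simp add: vanishing_column_def add.commute)
qed

lemma vanishing_column_even_left: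
  assumes "vanishing_column E x" "vanishing_column E (x + 1)" "odd x"
  shows "vanishing_column E (x - 1)"
  unfolding vanishing_column_def
proof (intro allI impI)
  fix y assume "in_domain (x - 1) y"
  then show "E (x - 1) y = 0"
    by (rule alternating_column_eq_0[rotated 3]) (use assms in \<open>auto intro: alternating_left axis\<close>)
qed

text \<open>
  Next to two zero columns, harmonicity makes the first unknown column on the left
  alternate, with values \<open>a, - a, a, \<dots>\<close>. These act as sources for the next column. There
  the values alternate in sign and grow linearly as \<open>4 * m * \<bar>a\<bar>\<close>. Boundedness forces
  \<open>a = 0\<close>.
\<close>

lemma vanishing_column_odd_left:
  assumes col: "vanishing_column E x" "vanishing_column E (x + 1)" and x: "even x"
    and bounded: "\<And>x y. in_domain x y \<Longrightarrow> \<bar>E x y\<bar> \<le> C"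
  shows "vanishing_column E (x - 1)"
proof -
  define a where "a = E (x - 1) 1"
  have odd_col: "E (x - 1) (2 * int m + 1) = (- 1) ^ m * a" for m
  proof (induction m)
    case (Suc m)
    have "E (x - 1) (2 * int m + 1 + 2) = - E (x - 1) (2 * int m + 1)"
      by (rule alternating_left[OF col]) (use x in \<open>simp add: in_domain_def\<close>)
    then show ?case using Suc by (simp add: algebra_simps)
  qed (simp add: a_def)
  have even_col: "E (x - 2) (2 * int m) = - ((- 1) ^ m * (4 * real m * a))" for m
  proof (induction m)
    case 0
    show ?case using axis[of "x - 2"] x by simp
  next
    case (Suc m)
    have z: "E x (2 * int m + 2) = 0" "E x (2 * int m) = 0"
      using col x by (auto simp: vanishing_column_def in_domain_def)
    have "4 * E (x - 1) (2 * int m + 1) = E x (2 * int m + 2) + E x (2 * int m)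
        + E (x - 2) (2 * int m + 2) + E (x - 2) (2 * int m)"
      using harmonic[of "x - 1" "2 * int m + 1"] x by (simp add: algebra_simps)
    then show ?case
      unfolding odd_col z Suc by (simp add: algebra_simps)
  qed
  have "a = 0"
  proof (rule ccontr)
    assume "a \<noteq> 0"
    then obtain m :: nat where m: "C < real m * \<bar>a\<bar>"
      using reals_Archimedean3[of "\<bar>a\<bar>"] by auto
    have "\<bar>E (x - 2) (2 * int m)\<bar> = 4 * (real m * \<bar>a\<bar>)"
      by (simp add: even_col abs_mult power_abs)
    moreover have "\<bar>E (x - 2) (2 * int m)\<bar> \<le> C"
      by (rule bounded) (use x in \<open>simp add: in_domain_def\<close>)
    moreover have "0 \<le> real m * \<bar>a\<bar>" by simp
    ultimately show False using m by linarith
  qed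
  show ?thesis
    unfolding vanishing_column_def
  proof (intro allI impI)
    fix y assume "in_domain (x - 1) y"
    then show "E (x - 1) y = 0"
      by (rule alternating_column_eq_0[rotated 3])
         (use col x \<open>a = 0\<close> in \<open>auto intro: alternating_left simp: a_def\<close>)
  qed
qed

lemma vanishing_column_nonpos:
  assumes bounded: "\<And>x y. in_domain x y \<Longrightarrow> \<bar>E x y\<bar> \<le> C"
  shows "vanishing_column E (- int n) \<and> vanishing_column E (1 - int n)"
proof (induction n)
  case 0
  show ?case using vanishing_column_nonneg[of 1] by simp
next
  case (Suc n)
  then have "vanishing_column E (- int n - 1)"
    using vanishing_column_even_left[of "- int n"] vanishing_column_odd_left[of "- int n" C] bounded
    by (cases "even n") (auto simp: add.commute)
  moreover have "- int (Suc n) = - int n - 1" "1 - int (Suc n) = - int n" by simp_all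
  ultimately show ?case using Suc by (simp only:)
qed

lemma vanishes:
  assumes dom: "in_domain x y"
    and "- 2 \<le> x \<or> (\<exists>C. \<forall>x y. in_domain x y \<longrightarrow> \<bar>E x y\<bar> \<le> C)"
  shows "E x y = 0"
proof -
  consider "0 \<le> x" | "x = - 1" | "x = - 2" | "x < - 2" by linarith
  then have "vanishing_column E x"
  proof cases
    case 1
    then show ?thesis using vanishing_column_nonneg[of "nat x"] by simp
  next
    case 2
    then show ?thesis using vanishing_column_minus_1 by simp
  next
    case 3
    then show ?thesis
      using vanishing_column_even_left[of "- 1"] vanishing_column_minus_1 vanishing_column_0 by simp
  next
    case 4
    then obtain C where "\<And>x y. in_domain x y \<Longrightarrow> \<bar>E x y\<bar> \<le> C" using assms(2) by auto
    from vanishing_column_nonpos[OF this, of "nat (- x)"] 4 show ?thesis by simp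
  qed
  then show ?thesis using dom by (simp add: vanishing_column_def)
qed

end

lemma green_relations_unique:
  assumes F: "green_relations F" and G: "green_relations G" and dom: "in_domain x y"
    and "- 2 \<le> x \<or> bounded_on_domain F \<and> bounded_on_domain G"
  shows "F x y = G x y"
proof -
  define E where "E x y = F x y - G x y" for x y
  have axis_eq: "F x 0 = G x 0" if even: "even x" for x
  proof (cases "0 \<le> x")
    case True
    obtain m where m: "x = 2 * m" using even by (elim evenE)
    have "F (2 * int k) 0 = G (2 * int k) 0" for k
      by (rule even_power_series_unique[where f = "\<lambda>z. 1 / sqrt (1 - z\<^sup>2)"])
         (use F G in \<open>auto simp: green_relations_def horizontal_axis_values_def\<close>)
    from this[of "nat m"] show ?thesis using True m by simp
  next
    case False
    then show ?thesis
      using F G even by (simp add: green_relations_def harmonicity_recurrence_def)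
  qed
  interpret homogeneous_relations E
  proof
    fix x y :: int assume "even (x + y)" "1 \<le> y"
    then have "4 * F x y = F (x + 1) (y + 1) + F (x + 1) (y - 1) + F (x - 1) (y + 1) + F (x - 1) (y - 1)"
      "4 * G x y = G (x + 1) (y + 1) + G (x + 1) (y - 1) + G (x - 1) (y + 1) + G (x - 1) (y - 1)"
      using F G by (auto simp: green_relations_def harmonicity_recurrence_def)
    then show "4 * E x y = E (x + 1) (y + 1) + E (x + 1) (y - 1) + E (x - 1) (y + 1) + E (x - 1) (y - 1)"
      by (simp add: E_def)
  next
    fix x :: int assume "even x" then show "E x 0 = 0" by (simp add: E_def axis_eq)
  next
    fix x :: int assume x: "even x" "0 \<le> x"
    have "H (x - 1) 1 + H (x + 1) 1 = 2 * H x 0 - (if x = 0 then 1 else 0)" if "green_relations H" for H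
      using that x by (cases "x = 0") (auto simp: green_relations_def harmonicity_recurrence_def)
    from this[OF F] this[OF G] show "E (x - 1) 1 + E (x + 1) 1 = 0"
      using axis_eq[OF x(1)] by (simp add: E_def)
  next
    fix k :: int assume "0 \<le> k"
    then have "H 0 (2 * k) + H 0 (2 * k + 2) = sqrt 2 * H (2 * k) 0" if "green_relations H" for H
      using that by (simp add: green_relations_def vertical_axis_relation_def)
    from this[OF F] this[OF G] show "E 0 (2 * k) + E 0 (2 * k + 2) = 0"
      using axis_eq[of "2 * k"] by (simp add: E_def)
  next
    fix y :: int assume "0 < y" "even y"
    then show "E 0 y = E (- 1) (y - 1)"
      using F G by (simp add: E_def green_relations_def adjacent_column_relation_def)
  qed
  have "- 2 \<le> x \<or> (\<exists>C. \<forall>x y. in_domain x y \<longrightarrow> \<bar>E x y\<bar> \<le> C)"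
  proof (cases "- 2 \<le> x")
    case False
    then obtain C C' where C: "\<And>x y. in_domain x y \<Longrightarrow> \<bar>F x y\<bar> \<le> C" "\<And>x y. in_domain x y \<Longrightarrow> \<bar>G x y\<bar> \<le> C'"
      using assms(4) by (auto simp: bounded_on_domain_def)
    have "\<bar>E x y\<bar> \<le> C + C'" if "in_domain x y" for x y
      using C(1)[OF that] C(2)[OF that] by (simp add: E_def)
    then show ?thesis by blast
  qed simp
  from vanishes[OF dom this] show ?thesis by (simp add: E_def)
qed

section \<open>Evaluation of programs\<close>

text \<open>
  The value of an expression when calls are answered by \<open>\<phi>\<close>. Unlike \<open>eval\<close> it is total and
  can be computed by rewriting, so that verifying a program amounts to checking the calls
  that are actually reached.
\<close>

fun denote :: "(nat \<Rightarrow> int list \<Rightarrow> int) \<Rightarrow> int list \<Rightarrow> expr \<Rightarrow> int" where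
  "denote \<phi> xs (Const c) = c"
| "denote \<phi> xs (Arg i) = xs ! i"
| "denote \<phi> xs (Add a b) = denote \<phi> xs a + denote \<phi> xs b"
| "denote \<phi> xs (Sub a b) = denote \<phi> xs a - denote \<phi> xs b"
| "denote \<phi> xs (Mul a b) = denote \<phi> xs a * denote \<phi> xs b"
| "denote \<phi> xs (IfLe a b c d) = (if denote \<phi> xs a \<le> denote \<phi> xs b then denote \<phi> xs c else denote \<phi> xs d)"
| "denote \<phi> xs (Call f es) = \<phi> f (map (denote \<phi> xs) es)"

fun calls_correct :: "program \<Rightarrow> (nat \<Rightarrow> int list \<Rightarrow> int) \<Rightarrow> int list \<Rightarrow> expr \<Rightarrow> bool" where
  "calls_correct P \<phi> xs (Const c) \<longleftrightarrow> True"
| "calls_correct P \<phi> xs (Arg i) \<longleftrightarrow> i < length xs"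
| "calls_correct P \<phi> xs (Add a b) \<longleftrightarrow> calls_correct P \<phi> xs a \<and> calls_correct P \<phi> xs b"
| "calls_correct P \<phi> xs (Sub a b) \<longleftrightarrow> calls_correct P \<phi> xs a \<and> calls_correct P \<phi> xs b"
| "calls_correct P \<phi> xs (Mul a b) \<longleftrightarrow> calls_correct P \<phi> xs a \<and> calls_correct P \<phi> xs b"
| "calls_correct P \<phi> xs (IfLe a b c d) \<longleftrightarrow> calls_correct P \<phi> xs a \<and> calls_correct P \<phi> xs b \<and>
     (if denote \<phi> xs a \<le> denote \<phi> xs b then calls_correct P \<phi> xs c else calls_correct P \<phi> xs d)"
| "calls_correct P \<phi> xs (Call f es) \<longleftrightarrow> (\<forall>e\<in>set es. calls_correct P \<phi> xs e) \<and>
     run P f (map (denote \<phi> xs) es) (\<phi> f (map (denote \<phi> xs) es))"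

lemma eval_denote: "calls_correct P \<phi> xs e \<Longrightarrow> eval P xs e (denote \<phi> xs e)"
proof (induction P \<phi> xs e rule: calls_correct.induct)
  case (6 P \<phi> xs a b c d)
  then show ?case by (auto intro: eval.intros split: if_splits)
next
  case (7 P \<phi> xs f es)
  then have "list_all2 (eval P xs) es (map (denote \<phi> xs) es)"
    by (simp add: list_all2_conv_all_nth)
  with 7 show ?case by (auto simp: run_def intro: eval.intros)
qed (auto intro: eval.intros)

lemma run_denoteI:
  assumes "f < length P" "calls_correct P \<phi> xs (P ! f)" "denote \<phi> xs (P ! f) = v"
  shows "run P f xs v"
  using assms eval_denote by (auto simp: run_def)

section \<open>A program for the Green's function\<close>

fun pow2 :: "int \<Rightarrow> int" where
  "pow2 m = (if m \<le> 0 then 1 else 2 * pow2 (m - 1))"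

text \<open>
  The number of paths of length \<open>n\<close> with steps \<open>1\<close> and \<open>- 1\<close> from \<open>j\<close> to \<open>0\<close>. The recursion
  yields the central binomial coefficients without division.
\<close>

function walk_count :: "int \<Rightarrow> int \<Rightarrow> int" where
  "walk_count n j = (if n \<le> 0 then (if j = 0 then 1 else 0)
     else walk_count (n - 1) (j - 1) + walk_count (n - 1) (j + 1))"
  by auto
termination by (relation "Wellfounded.measure (\<lambda>(n, j). nat n)") auto

text \<open>
  Multiplication by a power \<open>2 ^ N\<close> that is kept fixed throughout the recursion makes all
  values integers and leaves the linear relations unchanged.
\<close>

definition scaled_axis :: "int \<Rightarrow> int \<Rightarrow> int" where
  "scaled_axis N x = (if 0 \<le> x then pow2 (N - x) * walk_count x 0 else 0)"

text \<open>
  Column \<open>x\<close> is computed from the columns \<open>x - outward x\<close> and \<open>x - 2 * outward x\<close>, which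
  lead back to the columns \<open>0\<close> and \<open>- 1\<close>.
\<close>

definition outward :: "int \<Rightarrow> int" where
  "outward x = (if 0 < x then 1 else - 1)"

text \<open>
  The coefficient of \<open>1\<close> (for \<open>s = 0\<close>) or of \<open>sqrt 2\<close> (for \<open>s = 1\<close>) in \<open>2 ^ N * G_H x y\<close>,
  provided that \<open>\<bar>x\<bar> + y \<le> N\<close>. The factor \<open>sqrt 2\<close> enters only through the relation on the
  vertical axis. Columns are computed outwards from columns \<open>0\<close> and \<open>- 1\<close>: in height \<open>1\<close> by
  the known charge at the neighbouring point of the axis, above by harmonicity.
\<close>

function green_part :: "int \<Rightarrow> int \<Rightarrow> int \<Rightarrow> int \<Rightarrow> int" where
  "green_part s N x y =
     (if y \<le> 0 then (1 - s) * scaled_axis N x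
      else if x = 0 then s * scaled_axis N (y - 2) - green_part s N 0 (y - 2)
      else if x = - 1 then green_part s N 0 (y + 1)
      else if y = 1 then
        (1 - s) * (2 * scaled_axis N (x - outward x) - scaled_axis N (outward x - x)
                     + scaled_axis N (outward x - x - 2))
          - green_part s N (x - 2 * outward x) 1
      else 4 * green_part s N (x - outward x) (y - 1) - green_part s N x (y - 2)
        - green_part s N (x - 2 * outward x) y - green_part s N (x - 2 * outward x) (y - 2))"
  by auto
(* The call from column -1 raises the height by 1 while moving to column 0, which is why the rank of
   the column counts twice. *)
termination
  by (relation "Wellfounded.measure (\<lambda>(s, N, x, y). nat (2 * (if x = 0 then 0 else if 0 < x then x + 1 else - x) + y))")
     (auto simp: outward_def)

declare pow2.simps [simp del] walk_count.simps [simp del] green_part.simps [simp del]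

lemma green_part_cases:
  "y \<le> 0 \<Longrightarrow> green_part s N x y = (1 - s) * scaled_axis N x"
  "0 < y \<Longrightarrow> green_part s N 0 y = s * scaled_axis N (y - 2) - green_part s N 0 (y - 2)"
  "0 < y \<Longrightarrow> green_part s N (- 1) y = green_part s N 0 (y + 1)"
  "x \<noteq> 0 \<Longrightarrow> x \<noteq> - 1 \<Longrightarrow> green_part s N x 1 =
     (1 - s) * (2 * scaled_axis N (x - outward x) - scaled_axis N (outward x - x)
                  + scaled_axis N (outward x - x - 2))
       - green_part s N (x - 2 * outward x) 1"
  "1 < y \<Longrightarrow> x \<noteq> 0 \<Longrightarrow> x \<noteq> - 1 \<Longrightarrow> green_part s N x y =
     4 * green_part s N (x - outward x) (y - 1) - green_part s N x (y - 2)
       - green_part s N (x - 2 * outward x) y - green_part s N (x - 2 * outward x) (y - 2)"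
  by (simp_all add: green_part.simps[of s N x y] green_part.simps[of s N 0 y]
      green_part.simps[of s N "- 1" y] green_part.simps[of s N x 1])

definition scale_expr :: expr where
  "scale_expr = Add (IfLe (Const 0) (Arg 0) (Arg 0) (Sub (Const 0) (Arg 0))) (Arg 1)"

definition pow2_body :: expr where
  "pow2_body = IfLe (Arg 0) (Const 0) (Const 1) (Mul (Const 2) (Call 3 [Sub (Arg 0) (Const 1)]))"

definition walk_count_body :: expr where
  "walk_count_body = IfLe (Arg 0) (Const 0)
     (IfLe (Arg 1) (Const 0) (IfLe (Const 0) (Arg 1) (Const 1) (Const 0)) (Const 0))
     (Add (Call 4 [Sub (Arg 0) (Const 1), Sub (Arg 1) (Const 1)])
          (Call 4 [Sub (Arg 0) (Const 1), Add (Arg 1) (Const 1)]))"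

definition scaled_axis_body :: expr where
  "scaled_axis_body = IfLe (Const 0) (Arg 1)
     (Mul (Call 3 [Sub (Arg 0) (Arg 1)]) (Call 4 [Arg 1, Const 0])) (Const 0)"

definition outward_expr :: expr where
  "outward_expr = IfLe (Arg 2) (Const 0) (Const (- 1)) (Const 1)"

definition green_part_body :: expr where
  "green_part_body =
    (let axis = (\<lambda>x. Call 5 [Arg 1, x]); part = (\<lambda>x y. Call 6 [Arg 0, Arg 1, x, y]);
         x = Arg 2; y = Arg 3; d = outward_expr; x2 = Sub x (Mul (Const 2) d); y2 = Sub y (Const 2);
         if_eq = (\<lambda>a c e e'. IfLe a (Const c) (IfLe (Const c) a e e') e')
     in IfLe y (Const 0) (Mul (Sub (Const 1) (Arg 0)) (axis x))
       (if_eq x 0 (Sub (Mul (Arg 0) (axis y2)) (part (Const 0) y2))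
       (if_eq x (- 1) (part (Const 0) (Add y (Const 1)))
       (if_eq y 1
         (Sub (Mul (Sub (Const 1) (Arg 0))
                (Add (Sub (Mul (Const 2) (axis (Sub x d))) (axis (Sub d x)))
                     (axis (Sub (Sub d x) (Const 2)))))
              (part x2 (Const 1)))
         (Sub (Sub (Sub (Mul (Const 4) (part (Sub x d) (Sub y (Const 1)))) (part x y2)) (part x2 y))
              (part x2 y2))))))"

definition green_program :: program where
  "green_program =
    [Call 6 [Const 0, scale_expr, Arg 0, Arg 1], Call 6 [Const 1, scale_expr, Arg 0, Arg 1],
     scale_expr, pow2_body, walk_count_body, scaled_axis_body, green_part_body]"

lemma length_green_program [simp]: "length green_program = 7"
  by (simp add: green_program_def)

lemma nth_green_program:
  "green_program ! 0 = Call 6 [Const 0, scale_expr, Arg 0, Arg 1]"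
  "green_program ! Suc 0 = Call 6 [Const 1, scale_expr, Arg 0, Arg 1]"
  "green_program ! 2 = scale_expr"
  "green_program ! 3 = pow2_body"
  "green_program ! 4 = walk_count_body"
  "green_program ! 5 = scaled_axis_body"
  "green_program ! 6 = green_part_body"
  by (simp_all add: green_program_def)

definition called_value :: "nat \<Rightarrow> int list \<Rightarrow> int" where
  "called_value f xs =
     (if f = 3 then pow2 (xs ! 0)
      else if f = 4 then walk_count (xs ! 0) (xs ! 1)
      else if f = 5 then scaled_axis (xs ! 0) (xs ! 1)
      else green_part (xs ! 0) (xs ! 1) (xs ! 2) (xs ! 3))"

lemma called_value_simps [simp]:
  "called_value 3 [m] = pow2 m"
  "called_value 4 [n, j] = walk_count n j"
  "called_value 5 [N, x] = scaled_axis N x"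
  "called_value 6 [s, N, x, y] = green_part s N x y"
  by (simp_all add: called_value_def)

lemma run_pow2: "run green_program 3 [m] (pow2 m)"
proof (induction m rule: pow2.induct)
  case (1 m)
  then show ?case
    by (intro run_denoteI[where \<phi> = called_value])
       (auto simp: nth_green_program pow2_body_def pow2.simps[of m])
qed

lemma run_walk_count: "run green_program 4 [n, j] (walk_count n j)"
proof (induction n j rule: walk_count.induct)
  case (1 n j)
  then show ?case
    by (intro run_denoteI[where \<phi> = called_value])
       (auto simp: nth_green_program walk_count_body_def walk_count.simps[of n j])
qed

lemma run_scaled_axis: "run green_program 5 [N, x] (scaled_axis N x)"
  by (intro run_denoteI[where \<phi> = called_value])
     (auto simp: nth_green_program scaled_axis_body_def scaled_axis_def run_pow2 run_walk_count)

lemma denote_outward_expr: "denote \<phi> [s, N, x, y] outward_expr = outward x"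
  and calls_correct_outward_expr: "calls_correct P \<phi> [s, N, x, y] outward_expr"
  by (simp_all add: outward_expr_def outward_def)

lemma run_green_part: "run green_program 6 [s, N, x, y] (green_part s N x y)"
proof (induction s N x y rule: green_part.induct)
  case (1 s N x y)
  note sub = nth_green_program green_part_body_def denote_outward_expr calls_correct_outward_expr
    run_scaled_axis Let_def
  consider "y \<le> 0" | "0 < y" "x = 0" | "0 < y" "x = - 1" | "y = 1" "x \<noteq> 0" "x \<noteq> - 1"
    | "1 < y" "x \<noteq> 0" "x \<noteq> - 1" by linarith
  then show ?case
    by cases (use 1 in \<open>auto intro!: run_denoteI[where \<phi> = called_value] simp: sub green_part_cases\<close>)
qed

lemma run_green_program:
  assumes "in_domain x y"
  defines "N \<equiv> \<bar>x\<bar> + y"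
  shows "run green_program 0 [x, y] (green_part 0 N x y)"
    and "run green_program 1 [x, y] (green_part 1 N x y)"
    and "run green_program 2 [x, y] N"
proof -
  have N: "denote \<phi> [x, y] scale_expr = N" "calls_correct P \<phi> [x, y] scale_expr" for \<phi> P
    by (auto simp: scale_expr_def N_def)
  show "run green_program 0 [x, y] (green_part 0 N x y)"
    "run green_program 1 [x, y] (green_part 1 N x y)" "run green_program 2 [x, y] N"
    by (rule run_denoteI[where \<phi> = called_value]; simp add: nth_green_program N run_green_part)+
qed

lemma pow2_eq: "0 \<le> m \<Longrightarrow> pow2 m = 2 ^ nat m"
proof (induction m rule: pow2.induct)
  case (1 m)
  show ?case
  proof (cases "m = 0")
    case False
    then have "nat m = Suc (nat (m - 1))" using 1 by simp
    then show ?thesis using 1 False by (simp add: pow2.simps[of m])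
  qed (simp add: pow2.simps[of 0])
qed

lemma walk_count_outside: "max n 0 < \<bar>j\<bar> \<Longrightarrow> walk_count n j = 0"
proof (induction n j rule: walk_count.induct)
  case (1 n j)
  then show ?case by (subst walk_count.simps) auto
qed

lemma walk_count_eq: "walk_count (int n) (int n - 2 * int i) = int (n choose i)"
proof (induction n arbitrary: i)
  case 0
  show ?case by (cases i) (auto simp: walk_count.simps[of 0])
next
  case (Suc n)
  show ?case
  proof (cases i)
    case 0
    have "walk_count (int n) (int n + 2) = 0" by (rule walk_count_outside) simp
    then show ?thesis using Suc[of 0] 0 by (subst walk_count.simps) (simp add: add.commute)
  next
    case (Suc i')
    then show ?thesis using Suc.IH[of i'] Suc.IH[of i]
      by (subst walk_count.simps) (simp add: algebra_simps)
  qed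
qed

lemma scaled_axis_eq:
  assumes "even x" "x \<le> N"
  shows "of_int (scaled_axis N x) = 2 ^ nat N * axis_value x"
proof (cases "0 \<le> x")
  case True
  obtain m where m: "x = 2 * m" using assms by (elim evenE)
  define k where "k = nat m"
  have x: "x = 2 * int k" using True m by (simp add: k_def)
  have "walk_count x 0 = int ((2 * k) choose k)"
    using walk_count_eq[of "2 * k" k] by (simp add: x)
  moreover have "nat N = nat (N - x) + 2 * k" using assms True by (simp add: x)
  then have "(2::real) ^ nat N = 2 ^ nat (N - x) * 4 ^ k"
    by (simp add: power_add power_mult)
  ultimately show ?thesis
    using assms True by (simp add: scaled_axis_def axis_value_def pow2_eq cbin_def) (simp add: x)
qed (simp add: scaled_axis_def axis_value_def)

text \<open>
  The bound on \<open>N\<close> is inherited by all recursive calls and bounds the arguments at which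
  the axis values are used; it is what keeps the scaled axis values integral.
\<close>

lemma green_part_eq:
  assumes "in_domain x y" "\<bar>x\<bar> + y \<le> N"
  shows "2 ^ nat N * slit_green x y = of_int (green_part 0 N x y) + of_int (green_part 1 N x y) * sqrt 2"
  using assms
proof (induction "0::int" N x y rule: green_part.induct)
  case (1 N x y)
  let ?val = "\<lambda>x y. of_int (green_part 0 N x y) + of_int (green_part 1 N x y) * sqrt 2"
  have par: "even (x + y)" and y: "0 \<le> y" and N: "\<bar>x\<bar> + y \<le> N"
    using 1 by (auto simp: in_domain_def)
  consider "y = 0" | "0 < y" "x = 0" | "0 < y" "x = - 1" | "y = 1" "x \<noteq> 0" "x \<noteq> - 1"
    | "1 < y" "x \<noteq> 0" "x \<noteq> - 1" using y by linarith
  then show ?case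
  proof cases
    case 1
    then show ?thesis using par N
      by (simp add: green_part_cases slit_green_axis_value scaled_axis_eq)
  next
    case 2
    have IH: "2 ^ nat N * slit_green 0 (y - 2) = ?val 0 (y - 2)"
      using 2 par N by (intro "1.hyps"(1)) (auto simp: in_domain_def)
    obtain m where m: "y = 2 * m" using par 2 by (auto elim: evenE)
    have eq: "slit_green 0 y = sqrt 2 * axis_value (y - 2) - slit_green 0 (y - 2)"
      using slit_green_vertical[of "nat (m - 1)"] 2 m by (simp add: axis_value_def nat_diff_distrib)
    have "2 ^ nat N * slit_green 0 y
        = sqrt 2 * (2 ^ nat N * axis_value (y - 2)) - 2 ^ nat N * slit_green 0 (y - 2)"
      by (simp only: eq) (simp add: algebra_simps)
    then show ?thesis
      unfolding IH using 2 par N by (simp add: green_part_cases scaled_axis_eq algebra_simps)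
  next
    case 3
    have "2 ^ nat N * slit_green 0 (y + 1) = ?val 0 (y + 1)"
      using 3 par N by (intro "1.hyps"(2)) (auto simp: in_domain_def)
    then show ?thesis
      using 3 slit_green_adjacent[of "y + 1"] by (simp add: green_part_cases)
  next
    case 4
    define d where "d = outward x"
    have d: "d = 1 \<and> 0 < x \<or> d = - 1 \<and> x < - 1" using 4 by (auto simp: d_def outward_def)
    have e: "even (x - d)" using d par 4 by auto
    have IH: "2 ^ nat N * slit_green (x - 2 * d) 1 = ?val (x - 2 * d) 1"
      unfolding d_def using 4 par N d
      by (intro "1.hyps"(3)) (auto simp: in_domain_def d_def)
    have "slit_charge (x - d) = 2 * slit_green (x - d) 0 - slit_green x 1 - slit_green (x - 2 * d) 1"
      using d by (auto simp: slit_charge_def add.commute)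
    then have eq: "slit_green x 1 = 2 * axis_value (x - d) - axis_value (d - x) + axis_value (d - x - 2)
        - slit_green (x - 2 * d) 1"
      using slit_charge_axis_value[OF e] slit_green_axis_value[OF e] by simp
    have axis: "2 ^ nat N * axis_value (x - d) = of_int (scaled_axis N (x - d))"
      "2 ^ nat N * axis_value (d - x) = of_int (scaled_axis N (d - x))"
      "2 ^ nat N * axis_value (d - x - 2) = of_int (scaled_axis N (d - x - 2))"
      using e N d 4 by (auto intro!: scaled_axis_eq[symmetric])
    have scaled: "2 ^ nat N * slit_green x 1 = 2 * (2 ^ nat N * axis_value (x - d)) - 2 ^ nat N * axis_value (d - x)
        + 2 ^ nat N * axis_value (d - x - 2) - 2 ^ nat N * slit_green (x - 2 * d) 1"
      by (simp only: eq) (simp add: algebra_simps)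
    have part: "green_part s N x 1 = (1 - s) * (2 * scaled_axis N (x - d) - scaled_axis N (d - x)
        + scaled_axis N (d - x - 2)) - green_part s N (x - 2 * d) 1" for s
      unfolding d_def using 4(2,3) by (rule green_part_cases(4))
    show ?thesis
      unfolding 4(1) scaled IH axis part[of 0] part[of 1] by (simp add: algebra_simps)
  next
    case 5
    define d where "d = outward x"
    have d: "d = 1 \<and> 0 < x \<or> d = - 1 \<and> x < - 1" using 5 by (auto simp: d_def outward_def)
    have IH1: "2 ^ nat N * slit_green (x - d) (y - 1) = ?val (x - d) (y - 1)"
      unfolding d_def using 5 par N d by (intro "1.hyps"(4)) (auto simp: in_domain_def d_def)
    have IH2: "2 ^ nat N * slit_green x (y - 2) = ?val x (y - 2)"
      unfolding d_def using 5 par N d by (intro "1.hyps"(5)) (auto simp: in_domain_def d_def)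
    have IH3: "2 ^ nat N * slit_green (x - 2 * d) y = ?val (x - 2 * d) y"
      unfolding d_def using 5 par N d by (intro "1.hyps"(6)) (auto simp: in_domain_def d_def)
    have IH4: "2 ^ nat N * slit_green (x - 2 * d) (y - 2) = ?val (x - 2 * d) (y - 2)"
      unfolding d_def using 5 par N d by (intro "1.hyps"(7)) (auto simp: in_domain_def d_def)
    have "4 * slit_green (x - d) (y - 1) = slit_green x y + slit_green x (y - 2)
        + slit_green (x - 2 * d) y + slit_green (x - 2 * d) (y - 2)"
      using slit_green_harmonic[of "y - 1" "x - d"] d 5 by (auto simp: add.commute)
    then have eq: "slit_green x y = 4 * slit_green (x - d) (y - 1) - slit_green x (y - 2)
        - slit_green (x - 2 * d) y - slit_green (x - 2 * d) (y - 2)"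
      by linarith
    have scaled: "2 ^ nat N * slit_green x y = 4 * (2 ^ nat N * slit_green (x - d) (y - 1)) - 2 ^ nat N * slit_green x (y - 2)
        - 2 ^ nat N * slit_green (x - 2 * d) y - 2 ^ nat N * slit_green (x - 2 * d) (y - 2)"
      by (simp only: eq) (simp only: right_diff_distrib mult.left_commute)
    have part: "green_part s N x y = 4 * green_part s N (x - d) (y - 1) - green_part s N x (y - 2)
        - green_part s N (x - 2 * d) y - green_part s N (x - 2 * d) (y - 2)" for s
      unfolding d_def using 5 by (rule green_part_cases(5))
    show ?thesis
      unfolding scaled IH1 IH2 IH3 IH4 part[of 0] part[of 1] by (simp add: algebra_simps)
  qed
qed

lemma computes_at_slit_green:
  assumes "in_domain x y"
  shows "computes_at green_program x y (slit_green x y)"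
proof -
  define N where "N = \<bar>x\<bar> + y"
  have N: "0 \<le> N" using assms by (simp add: N_def in_domain_def)
  have "slit_green x y = (of_int (green_part 0 N x y) + of_int (green_part 1 N x y) * sqrt 2) / 2 ^ nat N"
    using green_part_eq[OF assms, of N] by (simp add: N_def field_simps)
  moreover have "run green_program 2 [x, y] (int (nat N))"
    using run_green_program(3)[OF assms] N by (simp add: N_def)
  ultimately show ?thesis
    unfolding computes_at_def using run_green_program(1,2)[OF assms, folded N_def] by blast
qed

lemma computes_at_imp_dyadic:
  assumes "computes_at P x y r"
  shows "r \<in> dyadic_sqrt2"
proof -
  from assms obtain p q :: int and n where "r = (of_int p + of_int q * sqrt 2) / 2 ^ n"
    by (auto simp: computes_at_def)
  then have "r = of_int p / 2 ^ n + of_int q / 2 ^ n * sqrt 2"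
    by (simp add: add_divide_distrib)
  then show ?thesis
    unfolding dyadic_sqrt2_def dyadic_rationals_def by blast
qed

lemma dyadic_sqrt2_subset: "dyadic_sqrt2 \<subseteq> rat_sqrt2"
proof -
  have "dyadic_rationals \<subseteq> \<rat>"
    by (auto simp: dyadic_rationals_def)
  then show ?thesis
    unfolding dyadic_sqrt2_def rat_sqrt2_def by blast
qed

section \<open>The relations and the computation\<close>

lemma horizontal_axis_values_G_H: "horizontal_axis_values G_H"
proof -
  have "G_H (2 * int k) 0 = cbin k" for k
    by (simp add: G_H_eq_slit_green in_domain_def slit_green_axis(1))
  then show ?thesis
    unfolding horizontal_axis_values_def using cbin_sums by simp
qed

lemma vertical_axis_relation_G_H: "vertical_axis_relation G_H"
  unfolding vertical_axis_relation_def
proof (intro allI impI)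
  fix k :: int assume "0 \<le> k"
  then obtain n where "k = int n" by (metis nonneg_int_cases)
  then show "G_H 0 (2 * k) + G_H 0 (2 * k + 2) = sqrt 2 * G_H (2 * k) 0"
    by (simp add: G_H_eq_slit_green in_domain_def slit_green_axis(1) slit_green_vertical)
qed

lemma adjacent_column_relation_G_H: "adjacent_column_relation G_H"
  by (simp add: adjacent_column_relation_def G_H_eq_slit_green in_domain_def slit_green_adjacent)

lemma harmonicity_recurrence_G_H: "harmonicity_recurrence G_H"
proof -
  have charge: "2 * G_H x 0 - G_H (x - 1) 1 - G_H (x + 1) 1 = axis_value (- x) - axis_value (- x - 2)"
    if "even x" for x
    using slit_charge_axis_value[OF that] that
    by (simp add: slit_charge_def G_H_eq_slit_green in_domain_def)
  have "4 * G_H x y = G_H (x + 1) (y + 1) + G_H (x + 1) (y - 1) + G_H (x - 1) (y + 1) + G_H (x - 1) (y - 1)"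
    if "even (x + y)" "1 \<le> y" for x y
    using that slit_green_harmonic[of y x] by (simp add: G_H_eq_slit_green in_domain_def)
  moreover have "2 * G_H x 0 = G_H (x - 1) 1 + G_H (x + 1) 1" if "0 < x" "even x" for x
    using charge[of x] that by (simp add: axis_value_def)
  moreover have "G_H x 0 = 0" if "x < 0" "even x" for x
    using that by (simp add: G_H_eq_slit_green in_domain_def slit_green_axis_value axis_value_def)
  moreover have "2 * G_H 0 0 - G_H 1 1 - G_H (- 1) 1 = 1"
    using charge[of 0] by (simp add: axis_value_def)
  ultimately show ?thesis
    by (simp add: harmonicity_recurrence_def)
qed

lemma bounded_on_domain_G_H: "bounded_on_domain G_H"
proof -
  have "\<bar>G_H x y\<bar> \<le> sqrt 2" if "in_domain x y" for x y
  proof -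
    have "\<bar>G_H x y\<bar> \<le> sqrt 2 * cbin (nat y div 2)"
      using abs_slit_green_le by (simp add: G_H_eq_slit_green[OF that])
    also have "\<dots> \<le> sqrt 2 * 1"
      by (intro mult_left_mono cbin_le_1) simp
    finally show ?thesis by simp
  qed
  then show ?thesis
    unfolding bounded_on_domain_def by blast
qed

theorem theorem3p2:
  shows "horizontal_axis_values G_H \<and> vertical_axis_relation G_H \<and>
         adjacent_column_relation G_H \<and> harmonicity_recurrence G_H \<and> bounded_on_domain G_H \<and>
         (\<exists>P. (\<forall>x y. in_domain x y \<longrightarrow> computes_at P x y (G_H x y)) \<and>
              (\<forall>F. green_relations F \<longrightarrow>
                 (\<forall>x y. in_domain x y \<and> (-2 \<le> x \<or> bounded_on_domain F) \<longrightarrow>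
                    computes_at P x y (F x y)))) \<and>
         (\<forall>x y. in_domain x y \<longrightarrow> G_H x y \<in> rat_sqrt2) \<and>
         (\<forall>x y. in_domain x y \<longrightarrow> G_H x y \<in> dyadic_sqrt2)"
proof -
  note relations = horizontal_axis_values_G_H vertical_axis_relation_G_H
    adjacent_column_relation_G_H harmonicity_recurrence_G_H
  have green: "green_relations G_H"
    using relations by (simp add: green_relations_def)
  have computes: "computes_at green_program x y (G_H x y)" if "in_domain x y" for x y
    using computes_at_slit_green[OF that] by (simp add: G_H_eq_slit_green[OF that])
  moreover have "computes_at green_program x y (F x y)"
    if "green_relations F" "in_domain x y" "- 2 \<le> x \<or> bounded_on_domain F" for F x y
    using green_relations_unique[OF that(1) green that(2)] that(3) bounded_on_domain_G_H
      computes[OF that(2)] by auto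
  moreover have "G_H x y \<in> dyadic_sqrt2" if "in_domain x y" for x y
    by (rule computes_at_imp_dyadic[OF computes[OF that]])
  moreover from this have "G_H x y \<in> rat_sqrt2" if "in_domain x y" for x y
    using that dyadic_sqrt2_subset by blast
  ultimately show ?thesis
    using relations bounded_on_domain_G_H by blast
qed

end
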